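(* Let $(k,q)$ be a semiprimitive pair with $q=p^m$, $m=2ts$, where $t$ is the least positive integer satisfying $k\mid p^t+1$, and put $n=\frac{q-1}{k}$, $\sigma=(-1)^{s+1}$ and $\lambda_2=-\frac{\sigma p^{m/2}+1}{k}$. Then: (a) $\Gamma(k,q)$ and $\bar\Gamma(k,q)$ are primitive, non-bipartite, integral, strongly regular graphs with corresponding parameters $srg(q,n,e,d)$ and $srg(q,(k-1)n,e',d')$ given by $$e=d+(\sigma p^{\frac m2}+2\lambda_2),\quad d=n+(\sigma p^{\frac m2}+\lambda_2)\lambda_2,\quad e'=q-2-2n+d,\quad d'=q-2n+e.$$ (b) $\Gamma(k,q)$ and $\bar\Gamma(k,q)$ are distance regular graphs of diameter $2$ with intersection arrays $$\mathcal{A}=\{n,n-e-1;1,d\}\qquad\text{and}\qquad\bar{\mathcal{A}}=\{(k-1)n,n-d;1,q-2n+e\}.$$ (c) If $s$ is odd, then $\Gamma(k,q)$ and $\bar\Gamma(k,q)$ are pseudo-Latin square graphs with parameters $$PL_\delta(w)=srg(w^2,\delta(w-1),\delta^2-3\delta+w,\delta(\delta-1)),$$ where $w=f-g$, $\delta=-g$ and $f>0>g$ are the non-trivial eigenvalues of $\Gamma(k,q)$ or $\bar\Gamma(k,q)$, respectively.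
   Context: Let $p$ be prime, $q=p^m$ and $k\mid q-1$. The generalized Paley graph $\Gamma(k,q)$ has vertex set $\mathbb{F}_q$ with $u,v$ adjacent iff $v-u\in\{x^k:x\in\mathbb{F}_q^*\}$, and $\bar\Gamma(k,q)$ is its complement. $(k,q)$ is a semiprimitive pair if either $k=2$ and $q\equiv1\pmod4$, or $k>2$, $k\mid p^{t'}+1$ for some positive integer $t'\mid\frac m2$ (with $m$ even), and $k\ne p^{\frac m2}+1$. A regular graph, neither complete nor empty, is strongly regular with parameters $srg(v,r,e,d)$ if it is $r$-regular with $v$ vertices, every two adjacent vertices have $e$ common neighbours and every two distinct non-adjacent vertices have $d$ common neighbours. It is primitive if it and its complement are connected. A graph is integral if all its adjacency eigenvalues are integers. A strongly regular graph $srg(v,r,e,d)$ with different eigenvalues $r>f>0>g$ is a pseudo-Latin square graph if $r=-g(f-g-1)$; equivalently it has the parameters $PL_\delta(w)$ displayed in the claim with $w=f-g$, $\delta=-g$. The non-trivial eigenvalues are those different from the degree of regularity. A regular graph is distance regular if for any two vertices $x,y$ the number of vertices at distance $j$ from $x$ and at distance $l$ from $y$ depends only on $j$, $l$ and $d(x,y)$. For a distance regular graph of diameter $2$ the intersection array is $\{b_0,b_1;c_1,c_2\}$, where for vertices $x,y$ at distance $i$, $b_i=\#\{z\in N(y):d(x,z)=i+1\}$ and $c_i=\#\{z\in N(y):d(x,z)=i-1\}$, $N(y)$ being the set of neighbours of $y$. *)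

theory Defs
  imports
    Complex_Main
    "HOL-Computational_Algebra.Primes"
    "Graph_Theory.Graph_Theory"
begin

text \<open>
  Graphs are finite simple undirected graphs, i.e. records of type \<open>'a pair_pre_digraph\<close>
  satisfying \<open>pair_graph\<close> (finite, loop-free, symmetric arc relation).
\<close>

definition neighbours :: "'a pair_pre_digraph \<Rightarrow> 'a \<Rightarrow> 'a set" where
  "neighbours G u = {v. (u, v) \<in> parcs G}"

definition graph_complement :: "'a pair_pre_digraph \<Rightarrow> 'a pair_pre_digraph" where
  "graph_complement G =
     \<lparr> pverts = pverts G,
       parcs = {(u, v). u \<in> pverts G \<and> v \<in> pverts G \<and> u \<noteq> v \<and> (u, v) \<notin> parcs G} \<rparr>"

definition regular_graph :: "'a pair_pre_digraph \<Rightarrow> nat \<Rightarrow> bool" where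
  "regular_graph G r \<longleftrightarrow> pair_graph G \<and> (\<forall>u \<in> pverts G. card (neighbours G u) = r)"

definition strongly_regular :: "'a pair_pre_digraph \<Rightarrow> nat \<Rightarrow> nat \<Rightarrow> nat \<Rightarrow> nat \<Rightarrow> bool" where
  "strongly_regular G v r e d \<longleftrightarrow>
     regular_graph G r \<and> card (pverts G) = v \<and>
     parcs G \<noteq> {} \<and> \<not> complete_digraph (card (pverts G)) (with_proj G) \<and>
     (\<forall>x \<in> pverts G. \<forall>y \<in> pverts G. (x, y) \<in> parcs G \<longrightarrow>
        card (neighbours G x \<inter> neighbours G y) = e) \<and>
     (\<forall>x \<in> pverts G. \<forall>y \<in> pverts G. x \<noteq> y \<and> (x, y) \<notin> parcs G \<longrightarrow>
        card (neighbours G x \<inter> neighbours G y) = d)"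

text \<open>The qualified name is needed because \<open>connected\<close> also denotes topological connectedness.\<close>

definition primitive_graph :: "'a pair_pre_digraph \<Rightarrow> bool" where
  "primitive_graph G \<longleftrightarrow>
     Digraph_Component.connected (with_proj G) \<and>
     Digraph_Component.connected (with_proj (graph_complement G))"

definition bipartite_graph :: "'a pair_pre_digraph \<Rightarrow> bool" where
  "bipartite_graph G \<longleftrightarrow>
     (\<exists>X Y. X \<union> Y = pverts G \<and> X \<inter> Y = {} \<and> parcs G \<subseteq> X \<times> Y \<union> Y \<times> X)"

text \<open>
  The equation \<open>A h = c h\<close> for the adjacency matrix \<open>A\<close> of \<open>G\<close>, with rows and columns indexed by
  the vertices: \<open>(A h)\<^sub>u\<close> is the sum of \<open>h\<close> over the neighbours of \<open>u\<close>.
\<close>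

definition adjacency_eigenvalues :: "'a pair_pre_digraph \<Rightarrow> complex set" where
  "adjacency_eigenvalues G =
     {c. \<exists>h :: 'a \<Rightarrow> complex. (\<exists>u \<in> pverts G. h u \<noteq> 0) \<and>
           (\<forall>u \<in> pverts G. (\<Sum>v \<in> neighbours G u. h v) = c * h u)}"

definition integral_graph :: "'a pair_pre_digraph \<Rightarrow> bool" where
  "integral_graph G \<longleftrightarrow> adjacency_eigenvalues G \<subseteq> \<int>"

definition nontrivial_eigenvalues :: "'a pair_pre_digraph \<Rightarrow> complex set" where
  "nontrivial_eigenvalues G =
     {c \<in> adjacency_eigenvalues G. \<forall>r. regular_graph G r \<longrightarrow> c \<noteq> of_nat r}"

definition pseudo_Latin_square_graph :: "'a pair_pre_digraph \<Rightarrow> bool" where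
  "pseudo_Latin_square_graph G \<longleftrightarrow>
     (\<exists>v r e d. \<exists>f g :: real.
        strongly_regular G v r e d \<and>
        adjacency_eigenvalues G = complex_of_real ` {real r, f, g} \<and>
        real r > f \<and> f > 0 \<and> 0 > g \<and>
        real r = - g * (f - g - 1))"

text \<open>
  The parameters \<open>PL\<^sub>\<delta>(w)\<close>. They are compared in the reals since \<open>\<delta>\<close> and \<open>w\<close> are computed from
  eigenvalues.
\<close>

definition has_PL_parameters :: "'a pair_pre_digraph \<Rightarrow> real \<Rightarrow> real \<Rightarrow> bool" where
  "has_PL_parameters G \<delta> w \<longleftrightarrow>
     (\<exists>v r e d. strongly_regular G v r e d \<and>
        real v = w\<^sup>2 \<and> real r = \<delta> * (w - 1) \<and>
        real e = \<delta>\<^sup>2 - 3 * \<delta> + w \<and> real d = \<delta> * (\<delta> - 1))"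

text \<open>
  The least number of arcs on a walk from \<open>u\<close> to \<open>v\<close> (\<open>\<infinity>\<close> if there is none), as the cost of a
  shortest path for unit arc costs.
\<close>

definition graph_dist :: "'a pair_pre_digraph \<Rightarrow> 'a \<Rightarrow> 'a \<Rightarrow> ereal" where
  "graph_dist G u v = wf_digraph.\<mu> (with_proj G) (\<lambda>_. 1) u v"

definition graph_diameter :: "'a pair_pre_digraph \<Rightarrow> ereal" where
  "graph_diameter G = (SUP u \<in> pverts G. SUP v \<in> pverts G. graph_dist G u v)"

definition distance_regular :: "'a pair_pre_digraph \<Rightarrow> bool" where
  "distance_regular G \<longleftrightarrow>
     (\<exists>r. regular_graph G r) \<and>
     (\<forall>x \<in> pverts G. \<forall>y \<in> pverts G. \<forall>x' \<in> pverts G. \<forall>y' \<in> pverts G.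
        graph_dist G x y = graph_dist G x' y' \<longrightarrow>
        (\<forall>j l :: nat.
           card {z \<in> pverts G. graph_dist G x z = ereal (real j) \<and> graph_dist G y z = ereal (real l)} =
           card {z \<in> pverts G. graph_dist G x' z = ereal (real j) \<and> graph_dist G y' z = ereal (real l)}))"

text \<open>
  The intersection array \<open>{b\<^sub>0, b\<^sub>1; c\<^sub>1, c\<^sub>2}\<close> of a distance regular graph of diameter \<open>2\<close>. The
  entries are integers to avoid truncated subtraction.
\<close>

definition has_intersection_array ::
    "'a pair_pre_digraph \<Rightarrow> int \<Rightarrow> int \<Rightarrow> int \<Rightarrow> int \<Rightarrow> bool" where
  "has_intersection_array G b\<^sub>0 b\<^sub>1 c\<^sub>1 c\<^sub>2 \<longleftrightarrow>
     (\<forall>x \<in> pverts G. \<forall>y \<in> pverts G.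
        (graph_dist G x y = 0 \<longrightarrow>
           int (card {z \<in> neighbours G y. graph_dist G x z = 1}) = b\<^sub>0) \<and>
        (graph_dist G x y = 1 \<longrightarrow>
           int (card {z \<in> neighbours G y. graph_dist G x z = 2}) = b\<^sub>1 \<and>
           int (card {z \<in> neighbours G y. graph_dist G x z = 0}) = c\<^sub>1) \<and>
        (graph_dist G x y = 2 \<longrightarrow>
           int (card {z \<in> neighbours G y. graph_dist G x z = 1}) = c\<^sub>2))"

text \<open>
  The vertex set is the whole field type; for a type of cardinality \<open>q\<close> this is \<open>\<Gamma>(k,q)\<close>.
\<close>

definition generalized_Paley_graph :: "nat \<Rightarrow> 'a::field pair_pre_digraph" where
  "generalized_Paley_graph k =
     \<lparr> pverts = UNIV, parcs = {(u, v). v - u \<in> {x ^ k | x. x \<noteq> 0}} \<rparr>"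

text \<open>The pair \<open>(k, p ^ m)\<close> is semiprimitive.\<close>

definition semiprimitive_pair :: "nat \<Rightarrow> nat \<Rightarrow> nat \<Rightarrow> bool" where
  "semiprimitive_pair k p m \<longleftrightarrow>
     (k = 2 \<and> p ^ m mod 4 = 1) \<or>
     (k > 2 \<and> even m \<and> (\<exists>t' > 0. t' dvd m div 2 \<and> k dvd p ^ t' + 1) \<and> k \<noteq> p ^ (m div 2) + 1)"

end

theory Submission
  imports Defs "HOL-Computational_Algebra.Polynomial" "HOL-Number_Theory.Cong"
begin

text \<open>
  Put \<open>P = p\<^sup>t\<close> and \<open>w = P\<^sup>s\<close>, so that \<open>q = w\<^sup>2\<close> and \<open>k\<close> divides \<open>P + 1\<close>. The graph is a
  Cayley graph on the additive group of the field, with the subgroup of nonzero \<open>k\<close>-th powers as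
  connection set. Everything rests on the values of the Gaussian periods of this subgroup, that is,
  the sums of \<open>\<psi> (b h)\<close> over all nonzero \<open>k\<close>-th powers \<open>h\<close>, for a Frobenius-invariant additive
  character \<open>\<psi>\<close>.

  The periods are computed without Gauss sums or Stickelberger's theorem. For the exponent \<open>P + 1\<close>
  the sum \<open>S a = \<Sum>\<^sub>x \<psi> (a x\<^bsup>P+1\<^esup>)\<close> is real, and expanding its square as for a Hermitian form
  gives \<open>S(a)\<^sup>2 = q P\<^sup>2\<close> for \<open>a\<close> in one coset of the \<open>(P+1)\<close>-th powers and \<open>S(a)\<^sup>2 = q\<close> on the
  other \<open>P\<close> cosets (\<open>S_square\<close>, \<open>card_radical\<close>). Since the values over all cosets add up to zero,
  \<open>S\<close> must be \<open>\<delta> P w\<close> on the exceptional coset and \<open>- \<delta> w\<close> on all others, for a sign \<open>\<delta>\<close>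
  (\<open>S_values\<close>). Averaging over the \<open>k\<close>-th powers yields the periods for every \<open>k\<close> dividing
  \<open>P + 1\<close> (\<open>period_values_upto_sign\<close>): they are \<open>l = - (\<delta> w + 1) / k\<close>, except on one coset, where
  they are \<open>l + \<delta> w\<close>.

  By Fourier inversion, two such period values turn the number of representations of \<open>a \<noteq> 0\<close> as a
  difference of two \<open>k\<close>-th powers into \<open>l (l + 1)\<close> or \<open>l (l + 1) + 2 l + \<delta> w\<close>, according to
  whether \<open>a\<close> is a \<open>k\<close>-th power (\<open>difference_count\<close>); this is strong regularity. Applied with
  \<open>k = P + 1\<close>, the integrality of this count also determines the sign, \<open>\<delta> = (- 1)\<^bsup>s+1\<^esup>\<close>
  (\<open>period_values\<close>).

  The remaining assertions hold for all strongly regular graphs with \<open>0 < d < r\<close> and are proved in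
  the locale \<open>primitive_srg\<close>, which applies to the graph and to its complement. The inequalities
  follow from the signs of the nontrivial eigenvalues \<open>L\<close> and \<open>f = L + \<sigma> w\<close>, because
  \<open>d = L (L + 1)\<close> and \<open>n - d = - L f\<close>, with \<open>- 1 - f\<close> and \<open>- 1 - L\<close> in place of \<open>L\<close> and \<open>f\<close> for the
  complement. The condition \<open>k \<noteq> p\<^bsup>m/2\<^esup> + 1\<close> is needed for \<open>L \<noteq> - 1\<close>.
\<close>

section \<open>Power subgroups of a finite field\<close>

text \<open>The subgroup of nonzero \<open>k\<close>-th powers.\<close>

definition kth_powers :: "nat \<Rightarrow> 'a::field set" where
  "kth_powers k = {x ^ k | x. x \<noteq> 0}"

lemma kth_powers_nonzero: "x \<in> kth_powers k \<Longrightarrow> x \<noteq> 0"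
  by (auto simp: kth_powers_def)

lemma kth_powersI: "x \<noteq> 0 \<Longrightarrow> x ^ k \<in> kth_powers k"
  unfolding kth_powers_def by blast

lemma kth_powers_one: "1 \<in> kth_powers k"
  unfolding kth_powers_def by (force intro: exI[of _ 1])

lemma kth_powers_mult: "x \<in> kth_powers k \<Longrightarrow> y \<in> kth_powers k \<Longrightarrow> x * y \<in> kth_powers k"
  unfolding kth_powers_def by (force simp flip: power_mult_distrib)

lemma kth_powers_inverse: "x \<in> kth_powers k \<Longrightarrow> inverse x \<in> kth_powers k"
  unfolding kth_powers_def by (force simp flip: power_inverse)

lemma kth_powers_mult_iff:
  assumes "x \<in> kth_powers k"
  shows "x * y \<in> kth_powers k \<longleftrightarrow> y \<in> kth_powers k"
proof
  assume "x * y \<in> kth_powers k"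
  then have "inverse x * (x * y) \<in> kth_powers k"
    by (rule kth_powers_mult[OF kth_powers_inverse[OF assms]])
  then show "y \<in> kth_powers k"
    using kth_powers_nonzero[OF assms] by (simp flip: mult.assoc)
qed (rule kth_powers_mult[OF assms])

lemma card_field_gt_1: "card (UNIV :: 'a::{field,finite} set) > 1"
proof -
  have "card {0, 1 :: 'a} \<le> card (UNIV :: 'a set)"
    by (intro card_mono) auto
  then show ?thesis by simp
qed

lemma power_card_minus_1:
  fixes x :: "'a::{field,finite}"
  assumes "x \<noteq> 0"
  shows "x ^ (card (UNIV :: 'a set) - 1) = 1"
proof -
  have "(\<Prod>y\<in>UNIV-{0}. y) = (\<Prod>y\<in>UNIV-{0}. x * y)"
    by (rule prod.reindex_bij_witness[of _ "\<lambda>y. x * y" "\<lambda>y. y / x"]) (use assms in auto)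
  also have "\<dots> = x ^ (card (UNIV :: 'a set) - 1) * (\<Prod>y\<in>UNIV-{0}. y)"
    by (simp add: prod.distrib)
  finally show ?thesis
    by (simp add: prod_zero_iff)
qed

lemma card_power_eq_1_le:
  fixes k :: nat
  assumes "k > 0"
  shows "card {x :: 'a::{field,finite}. x ^ k = 1} \<le> k"
proof -
  let ?f = "monom 1 k - 1 :: 'a poly"
  have deg: "degree ?f = k"
    using assms by (metis degree_1 degree_add_eq_left degree_minus degree_monom_eq diff_conv_add_uminus one_neq_zero)
  then have "?f \<noteq> 0" using assms by (metis degree_0 less_irrefl)
  from card_poly_roots_bound[OF this] deg show ?thesis
    by (simp add: poly_monom)
qed

lemma card_kth_power_fibre:
  fixes x :: "'a::{field,finite}"
  assumes "x \<noteq> 0" 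
  shows "card {z. z ^ k = x ^ k} = card {z :: 'a. z ^ k = 1}"
  by (rule bij_betw_same_card[of "\<lambda>z. z / x"], rule bij_betwI[of _ _ _ "\<lambda>z. z * x"])
     (use assms in \<open>auto simp: power_divide power_mult_distrib\<close>)

text \<open>
  The two standard descriptions of the \<open>k\<close>-th powers when \<open>k\<close> divides \<open>q - 1\<close>. Both \<open>X\<^sup>k - 1\<close>
  and \<open>X\<^bsup>(q-1)/k\<^esup> - 1\<close> have at most as many roots as their degrees, and the fibres of
  \<open>x \<mapsto> x\<^sup>k\<close> force equality in both bounds, so no primitive root is needed.
\<close>

lemma
  fixes k :: nat
  assumes k: "k dvd card (UNIV :: 'a::{field,finite} set) - 1"
  shows card_power_eq_1: "card {x :: 'a. x ^ k = 1} = k"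
    and kth_powers_eq_roots: "kth_powers k = {y :: 'a. y ^ ((card (UNIV :: 'a set) - 1) div k) = 1}"
    and card_kth_powers: "card (kth_powers k :: 'a set) = (card (UNIV :: 'a set) - 1) div k"
proof -
  let ?q = "card (UNIV :: 'a set)"
  let ?n = "(?q - 1) div k"
  let ?N = "card {x :: 'a. x ^ k = 1}"
  have q1: "?q - 1 > 0" using card_field_gt_1[where 'a='a] by simp
  have kn: "k * ?n = ?q - 1" using k by simp
  then have k0: "k > 0" and n0: "?n > 0"
    using q1 by (metis bot_nat_0.not_eq_extremum mult_is_0)+
  have img: "kth_powers k = (\<lambda>x :: 'a. x ^ k) ` (UNIV - {0})"
    by (auto simp: kth_powers_def)
  have sub: "kth_powers k \<subseteq> {y :: 'a. y ^ ?n = 1}"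
    using power_card_minus_1 kn by (auto simp: kth_powers_def simp flip: power_mult)
  have "?q - 1 = card (UNIV - {0 :: 'a})" by simp
  also have "\<dots> = (\<Sum>y\<in>kth_powers k. card {z :: 'a. z \<noteq> 0 \<and> z ^ k = y})"
    unfolding img by (subst card_eq_sum, subst sum.image_gen[where g = "\<lambda>x. x ^ k"]) auto
  also have "\<dots> = (\<Sum>y\<in>(kth_powers k :: 'a set). ?N)"
  proof (rule sum.cong)
    fix y :: 'a assume "y \<in> kth_powers k"
    then obtain x where x: "x \<noteq> 0" "y = x ^ k" by (auto simp: kth_powers_def)
    then have "{z. z \<noteq> 0 \<and> z ^ k = y} = {z. z ^ k = x ^ k}"
      using k0 by (auto simp: power_0_left)
    then show "card {z. z \<noteq> 0 \<and> z ^ k = y} = ?N"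
      using card_kth_power_fibre[OF x(1)] by simp
  qed simp
  also have "\<dots> = ?N * card (kth_powers k :: 'a set)" by simp
  finally have prd: "k * ?n = ?N * card (kth_powers k :: 'a set)" using kn by simp
  have le1: "?N \<le> k" by (rule card_power_eq_1_le[OF k0])
  have le2: "card (kth_powers k :: 'a set) \<le> card {y :: 'a. y ^ ?n = 1}"
    by (rule card_mono[OF _ sub]) simp
  have le3: "card {y :: 'a. y ^ ?n = 1} \<le> ?n" by (rule card_power_eq_1_le[OF n0])
  have "\<not> ?N < k"
  proof
    assume "?N < k"
    then have "?N * card (kth_powers k :: 'a set) < k * ?n"
      using le2 le3 n0 by (meson le_less_trans less_le_trans mult_le_mono2 mult_less_mono1 order.trans)
    then show False using prd by simp
  qed
  then show N: "?N = k" using le1 by simp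
  then show c: "card (kth_powers k :: 'a set) = ?n" using prd k0 by simp
  show "kth_powers k = {y :: 'a. y ^ ?n = 1}"
    by (rule card_subset_eq[OF _ sub]) (use c le2 le3 in auto)
qed

section \<open>A Frobenius-invariant additive character\<close>

lemma CHAR_finite_field:
  assumes "prime p" and card: "card (UNIV :: 'a::{field,finite} set) = p ^ m"
  shows "CHAR('a) = p"
proof -
  have "(\<Sum>x\<in>UNIV. x :: 'a) = (\<Sum>x\<in>UNIV. x + 1)"
    by (rule sum.reindex_bij_witness[of _ "\<lambda>y. y + 1" "\<lambda>y. y - 1"]) auto
  also have "\<dots> = (\<Sum>x\<in>UNIV. x) + of_nat (card (UNIV :: 'a set))"
    by (simp add: sum.distrib)
  finally have "of_nat (card (UNIV :: 'a set)) = (0 :: 'a)" by simp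
  then have "CHAR('a) dvd p ^ m" by (metis card of_nat_eq_0_iff_char_dvd)
  moreover have "prime CHAR('a)"
    by (rule prime_CHAR_semidom) (simp add: finite_imp_CHAR_pos)
  ultimately show ?thesis
    using \<open>prime p\<close> by (metis prime_dvd_power primes_dvd_imp_eq)
qed

text \<open>The absolute trace of a field with \<open>p ^ m\<close> elements, with values in the field itself.\<close>

definition field_trace :: "nat \<Rightarrow> nat \<Rightarrow> 'a::field \<Rightarrow> 'a" where
  "field_trace p m x = (\<Sum>i<m. x ^ (p ^ i))"

text \<open>
  A nontrivial additive character \<open>\<psi>\<close> of a field with \<open>p ^ m\<close> elements that is invariant under
  \<open>x \<mapsto> x\<^sup>p\<close> and trivial on the elements of trace zero. No other property of the canonical
  character \<open>x \<mapsto> exp (2 \<pi> i Tr x / p)\<close> enters the computation of the periods.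
\<close>

locale frobenius_character =
  fixes p m :: nat and \<psi> :: "'a::{field,finite} \<Rightarrow> complex"
  assumes prime_p: "prime p"
    and card_field: "card (UNIV :: 'a set) = p ^ m"
    and psi_add: "\<psi> (x + y) = \<psi> x * \<psi> y"
    and psi_frobenius: "\<psi> (x ^ p) = \<psi> x"
    and psi_trace_0: "field_trace p m x = 0 \<Longrightarrow> \<psi> x = 1"
    and psi_nontrivial: "\<exists>x. \<psi> x \<noteq> 1"

text \<open>
  The canonical character. The trace takes values in the prime field, so it is the image of a unique
  \<open>\<tau> x < p\<close>, and \<open>\<psi> x\<close> is the \<open>\<tau> x\<close>-th power of a primitive \<open>p\<close>-th root of unity.
\<close>

lemma exists_frobenius_character:
  assumes p: "prime p" and card: "card (UNIV :: 'a::{field,finite} set) = p ^ m"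
  shows "\<exists>\<psi> :: 'a \<Rightarrow> complex. frobenius_character p m \<psi>"
proof -
  let ?T = "field_trace p m :: 'a \<Rightarrow> 'a"
  have ch: "CHAR('a) = p" by (rule CHAR_finite_field[OF p card])
  have p0: "p > 1" using p by (rule prime_gt_1_nat)
  have m0: "m > 0" using card card_field_gt_1[where 'a='a] by (auto intro: Nat.gr0I)
  have full: "x ^ (p ^ m) = x" for x :: 'a
  proof (cases "x = 0")
    case False
    then show ?thesis
      using power_card_minus_1[OF False] card_field_gt_1[where 'a='a] unfolding card
      by (metis less_imp_le_nat mult.right_neutral power_minus_mult less_trans zero_less_one mult_1)
  qed (use p0 in auto)
  have Tadd: "?T (x + y) = ?T x + ?T y" for x y
    unfolding field_trace_def using p ch
    by (simp add: freshmans_dream'[where n = i for i] sum.distrib)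
  have shift: "(\<Sum>i<m. x ^ (p ^ Suc i)) = ?T x" for x :: 'a
  proof -
    have "(\<Sum>i<Suc m. x ^ (p ^ i)) = x + (\<Sum>i<m. x ^ (p ^ Suc i))"
      by (simp add: sum.lessThan_Suc_shift del: sum.lessThan_Suc)
    moreover have "(\<Sum>i<Suc m. x ^ (p ^ i)) = ?T x + x"
      by (simp add: field_trace_def full)
    ultimately show ?thesis by simp
  qed
  have Tfrob: "?T (x ^ p) = ?T x" for x
    using shift[of x] by (simp add: field_trace_def power_mult)
  have Tpow: "?T x ^ p = ?T x" for x
  proof -
    have "?T x ^ p = (\<Sum>i<m. (x ^ (p ^ i)) ^ p)"
      unfolding field_trace_def using p ch by (intro freshmans_dream_sum) auto
    also have "\<dots> = ?T x" using shift[of x] by (simp add: mult.commute flip: power_mult)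
    finally show ?thesis .
  qed
  \<comment> \<open>The trace takes values in the prime field, which consists of the roots of \<open>X\<^sup>p - X\<close>.\<close>
  have inj: "inj_on (of_nat :: nat \<Rightarrow> 'a) {..<p}"
  proof (rule inj_onI)
    fix i j assume ij: "i \<in> {..<p}" "j \<in> {..<p}" "(of_nat i :: 'a) = of_nat j"
    then have "[i = j] (mod p)" using ch by (simp add: of_nat_eq_iff_cong_CHAR)
    then show "i = j" using ij by (simp add: cong_def)
  qed
  have frob_nat: "(of_nat j :: 'a) ^ p = of_nat j" for j
    using p p0 ch by (induction j) (auto simp: freshmans_dream)
  let ?f = "monom 1 p - monom 1 1 :: 'a poly"
  have "coeff ?f p \<noteq> 0" using p0 by (simp add: coeff_monom)
  then have f0: "?f \<noteq> 0" by (metis coeff_0)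
  have "degree ?f \<le> p" using p0 by (intro degree_diff_le) (auto simp: degree_monom_eq)
  then have "card {x. poly ?f x = 0} \<le> p"
    using card_poly_roots_bound[OF f0] by linarith
  moreover have "of_nat ` {..<p} \<subseteq> {x. poly ?f x = 0}"
    by (auto simp: poly_monom frob_nat)
  moreover have "card (of_nat ` {..<p} :: 'a set) = p"
    using card_image[OF inj] by simp
  ultimately have roots: "of_nat ` {..<p} = {x. poly ?f x = 0}"
    by (intro card_seteq) auto
  have "\<exists>j<p. of_nat j = ?T x" for x
  proof -
    have "?T x \<in> {x. poly ?f x = 0}" by (simp add: poly_monom Tpow)
    then show ?thesis unfolding roots[symmetric] by auto
  qed
  then obtain \<tau> where tau: "\<And>x. \<tau> x < p" "\<And>x. of_nat (\<tau> x) = ?T x" by metis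
  define \<psi> :: "'a \<Rightarrow> complex" where "\<psi> x = cis (2 * pi / real p) ^ \<tau> x" for x
  have zp: "cis (2 * pi / real p) ^ p = 1"
    using p0 by (simp add: DeMoivre)
  have psi_eq: "\<psi> x = cis (2 * pi / real p) ^ j" if "of_nat j = ?T x" for x j
  proof -
    have "[\<tau> x = j] (mod p)" using that tau(2)[of x] ch by (metis of_nat_eq_iff_cong_CHAR)
    then have jt: "j mod p = \<tau> x" using tau(1)[of x] by (simp add: cong_def)
    have "cis (2 * pi / real p) ^ j = cis (2 * pi / real p) ^ (p * (j div p) + j mod p)" by simp
    also have "\<dots> = \<psi> x" unfolding power_add power_mult zp jt \<psi>_def by simp
    finally show ?thesis ..
  qed
  have add: "\<psi> (x + y) = \<psi> x * \<psi> y" for x y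
    using psi_eq[of "\<tau> x + \<tau> y" "x + y"] tau(2) Tadd by (simp add: \<psi>_def power_add)
  have "?T 0 = 0" using p0 by (simp add: field_trace_def power_0_left)
  then have tr0: "\<psi> x = 1" if "?T x = 0" for x
    using psi_eq[of 0 x] that by simp
  have frob: "\<psi> (x ^ p) = \<psi> x" for x
    using psi_eq[of "\<tau> x" "x ^ p"] tau(2) Tfrob by (simp add: \<psi>_def)
  have nontriv: "\<exists>x. \<psi> x \<noteq> 1"
  proof -
    \<comment> \<open>The trace is a polynomial function of degree below \<open>p ^ m\<close>, hence not identically zero.\<close>
    let ?g = "\<Sum>i<m. monom 1 (p ^ i) :: 'a poly"
    have "degree ?g \<le> p ^ (m - 1)"
    proof (rule degree_sum_le)
      fix i assume "i \<in> {..<m}"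
      then show "degree (monom 1 (p ^ i) :: 'a poly) \<le> p ^ (m - 1)"
        using p0 by (auto simp: degree_monom_eq intro!: power_increasing)
    qed simp
    also have "\<dots> < p ^ m" using p0 m0 by simp
    finally have deg: "degree ?g < p ^ m" .
    have "coeff ?g (p ^ 0) = (\<Sum>i<m. if i = 0 then 1 else 0)"
      unfolding coeff_sum coeff_monom using p0 by (intro sum.cong) auto
    also have "\<dots> = 1" using m0 by simp
    finally have "?g \<noteq> 0" by (metis coeff_0 zero_neq_one)
    then have "card {x. poly ?g x = 0} < card (UNIV :: 'a set)"
      using card_poly_roots_bound[of ?g] deg card by linarith
    then have "{x. poly ?g x = 0} \<noteq> UNIV" by auto
    then obtain x where x: "?T x \<noteq> 0"
      by (auto simp: poly_sum poly_monom field_trace_def)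
    have t: "0 < \<tau> x" using x tau(2)[of x] by (auto intro: Nat.gr0I)
    have "\<psi> x = cis (2 * pi * (real (\<tau> x) / real p))"
      by (simp add: \<psi>_def DeMoivre mult_ac)
    moreover have "cis (2 * pi * (real (\<tau> x) / real p)) \<noteq> 1"
    proof
      assume "cis (2 * pi * (real (\<tau> x) / real p)) = 1"
      then have "cos (2 * pi * (real (\<tau> x) / real p)) = 1" by (simp add: complex_eq_iff)
      then obtain n :: int where "2 * pi * (real (\<tau> x) / real p) = of_int n * 2 * pi"
        using cos_one_2pi_int by blast
      then have "(2 * pi) * (real (\<tau> x) / real p) = (2 * pi) * of_int n" by (simp add: mult_ac)
      then have n: "real (\<tau> x) / real p = of_int n" unfolding mult_cancel_left by simp
      moreover have "0 < real (\<tau> x) / real p" "real (\<tau> x) / real p < 1"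
        using t p0 tau(1)[of x] by auto
      ultimately have "0 < n" "n < 1" by (metis of_int_0_less_iff, metis of_int_less_1_iff)
      then show False by simp
    qed
    ultimately show ?thesis by metis
  qed
  have "frobenius_character p m \<psi>"
    by unfold_locales (use p card add frob tr0 nontriv in auto)
  then show ?thesis by blast
qed

section \<open>Gaussian periods of the power subgroups\<close>

lemma dvd_of_quadratic:
  fixes A M c :: int
  assumes "A * (A + M) = c * M\<^sup>2" "M \<noteq> 0"
  shows "M dvd A"
proof -
  have "(2 * A + M)\<^sup>2 = (4 * c + 1) * M\<^sup>2"
    using assms(1) by (simp add: power2_eq_square algebra_simps)
  then have "M\<^sup>2 dvd (2 * A + M)\<^sup>2" by simp
  then have "M dvd 2 * A + M" by simp
  then obtain u where u: "2 * A + M = M * u" by (elim dvdE)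
  then have "M\<^sup>2 * u\<^sup>2 = M\<^sup>2 * (4 * c + 1)"
    using \<open>(2 * A + M)\<^sup>2 = (4 * c + 1) * M\<^sup>2\<close> by (simp add: power_mult_distrib mult.commute)
  then have "u\<^sup>2 = 4 * c + 1" using assms(2) by simp
  then have "odd (u\<^sup>2)" by simp
  then have "odd u" by simp
  then obtain v where "u = 2 * v + 1" by (elim oddE)
  then have "A = M * v" using u by (simp add: algebra_simps)
  then show ?thesis by simp
qed

context frobenius_character
begin

lemma p_gt_1: "p > 1" using prime_p by (rule prime_gt_1_nat)

lemma char_p: "CHAR('a) = p" using prime_p card_field by (rule CHAR_finite_field)

lemma psi_0: "\<psi> 0 = 1"
  by (rule psi_trace_0) (use p_gt_1 in \<open>simp add: field_trace_def power_0_left\<close>)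

lemma psi_frobenius_power: "\<psi> (x ^ (p ^ t)) = \<psi> x"
  by (induction t arbitrary: x) (simp_all add: power_mult psi_frobenius)

lemma sum_psi: "(\<Sum>x\<in>UNIV. \<psi> (b * x)) = (if b = 0 then of_nat (p ^ m) else 0)"
proof (cases "b = 0")
  case True
  then show ?thesis by (simp add: psi_0 card_field)
next
  case False
  obtain c where c: "\<psi> c \<noteq> 1" using psi_nontrivial by blast
  have "(\<Sum>x\<in>UNIV. \<psi> (b * x)) = (\<Sum>x\<in>UNIV. \<psi> (b * (x + c / b)))"
    by (rule sum.reindex_bij_witness[of _ "\<lambda>x. x + c / b" "\<lambda>x. x - c / b"]) auto
  also have "\<dots> = (\<Sum>x\<in>UNIV. \<psi> (b * x)) * \<psi> c"
    using False by (simp add: distrib_left psi_add sum_distrib_right)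
  finally show ?thesis using c False by simp
qed

lemma period_mult_kth_power:
  assumes "u \<in> kth_powers k"
  shows "(\<Sum>h\<in>kth_powers k. f (u * h)) = (\<Sum>h\<in>kth_powers k. f (h :: 'a) :: complex)"
  using assms kth_powers_nonzero[OF assms]
  by (intro sum.reindex_bij_witness[of _ "\<lambda>h. h / u" "\<lambda>h. u * h"])
     (auto simp: divide_inverse mult.commute[of _ "inverse u"]
       intro!: kth_powers_mult kth_powers_inverse)

text \<open>
  If the periods over the subgroup \<open>H\<close> take the value \<open>l + W\<close> on the coset of all \<open>b\<close> with
  \<open>b g \<in> H\<close> and \<open>l\<close> on all other nonzero elements, where \<open>W\<^sup>2 = q\<close>, Fourier inversion shows that the number of representations of \<open>a \<noteq> 0\<close> as
  a difference of two elements of \<open>H\<close> depends only on whether \<open>a \<in> H\<close>.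
\<close>

lemma difference_count:
  fixes W l :: complex and g a :: 'a and k :: nat and H :: "'a set"
  defines "H \<equiv> kth_powers k"
  assumes k: "k dvd p ^ m - 1" and minus: "- 1 \<in> H" and g: "g \<noteq> 0"
    and W: "W * W = of_nat (p ^ m)" and l: "of_nat k * l = - (W + 1)"
    and period: "\<And>b. b \<noteq> 0 \<Longrightarrow> (\<Sum>h\<in>H. \<psi> (b * h)) = l + (if b * g \<in> H then W else 0)"
    and a: "a \<noteq> 0"
  shows "of_nat (card {(x, y). x \<in> H \<and> y \<in> H \<and> x - y = a}) =
    l * (l + 1) + (if a \<in> H then 2 * l + W else 0)"
proof -
  let ?n = "of_nat (card H) :: complex"
  let ?\<eta> = "\<lambda>b. \<Sum>h\<in>H. \<psi> (b * h)"
  have q0: "p ^ m > 0" using p_gt_1 by simp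
  have k0: "k > 0" using k card_field_gt_1[where 'a='a] card_field by (auto intro: Nat.gr0I)
  have "of_nat k * ?n = of_nat (p ^ m - 1)"
    using card_kth_powers[of k, where 'a='a] k unfolding H_def card_field by (simp flip: of_nat_mult)
  also have "\<dots> = W * W - 1"
  proof -
    have "of_nat (r - 1) = of_nat r - (1 :: complex)" if "r > 0" for r
      using that by (cases r) auto
    then show ?thesis using q0 unfolding W by blast
  qed
  also have "\<dots> = - (of_nat k * l) * (W - 1)"
    unfolding l by (simp add: algebra_simps)
  also have "\<dots> = of_nat k * (- l * (W - 1))" by simp
  finally have "of_nat k * ?n = of_nat k * (- l * (W - 1))" .
  moreover have "of_nat k \<noteq> (0 :: complex)" using k0 by simp
  ultimately have n: "?n = - l * (W - 1)" by (metis mult_left_cancel)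
  have neg: "(\<Sum>h\<in>H. \<psi> (- (b * h))) = ?\<eta> b" for b
    using period_mult_kth_power[OF minus[unfolded H_def], of "\<lambda>h. \<psi> (b * h)"] by (simp add: H_def)
  have ind: "(\<Sum>b\<in>UNIV. \<psi> (b * (x - y - a))) = of_nat (p ^ m) * (if x - y = a then 1 else 0)" for x y
    using sum_psi[of "x - y - a"] by (simp add: mult.commute)
  have cnt: "of_nat (card {(x, y). x \<in> H \<and> y \<in> H \<and> x - y = a}) =
      (\<Sum>x\<in>H. \<Sum>y\<in>H. if x - y = a then 1 else 0 :: complex)"
  proof -
    have "{(x, y). x \<in> H \<and> y \<in> H \<and> x - y = a} = {z \<in> H \<times> H. fst z - snd z = a}" by auto
    also have "of_nat (card \<dots>) = (\<Sum>z\<in>H \<times> H. if fst z - snd z = a then 1 else 0 :: complex)"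
      by (simp add: sum.If_cases Int_def)
    finally show ?thesis by (simp add: sum.cartesian_product case_prod_beta)
  qed
  have "of_nat (p ^ m) * of_nat (card {(x, y). x \<in> H \<and> y \<in> H \<and> x - y = a}) =
      (\<Sum>x\<in>H. \<Sum>y\<in>H. \<Sum>b\<in>UNIV. \<psi> (b * (x - y - a)))"
    unfolding cnt ind by (simp add: sum_distrib_left)
  also have "\<dots> = (\<Sum>x\<in>H. \<Sum>y\<in>H. \<Sum>b\<in>UNIV. \<psi> (b * x) * \<psi> (- (b * y)) * \<psi> (- (b * a)))"
    by (simp add: algebra_simps flip: psi_add)
  also have "\<dots> = (\<Sum>b\<in>UNIV. \<Sum>x\<in>H. \<Sum>y\<in>H. \<psi> (b * x) * \<psi> (- (b * y)) * \<psi> (- (b * a)))"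
    by (subst sum.swap[of _ UNIV], intro sum.cong refl sum.swap)
  also have "\<dots> = (\<Sum>b\<in>UNIV. ?\<eta> b * (\<Sum>y\<in>H. \<psi> (- (b * y))) * \<psi> (- (b * a)))"
    unfolding sum_product by (simp only: sum_distrib_right)
  also have "\<dots> = (\<Sum>b\<in>UNIV. ?\<eta> b * ?\<eta> b * \<psi> (- (b * a)))"
    unfolding neg ..
  also have "\<dots> = ?n * ?n + (\<Sum>b\<in>UNIV - {0}. ?\<eta> b * ?\<eta> b * \<psi> (- (b * a)))"
    by (subst sum.remove[of _ 0]) (simp_all add: psi_0)
  also have "(\<Sum>b\<in>UNIV - {0}. ?\<eta> b * ?\<eta> b * \<psi> (- (b * a))) =
      (\<Sum>b\<in>UNIV - {0}. l * l * \<psi> (- (b * a)) +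
        (2 * l * W + W * W) * (if b * g \<in> H then \<psi> (- (b * a)) else 0))"
    by (rule sum.cong) (auto simp: period algebra_simps)
  also have "\<dots> = l * l * (\<Sum>b\<in>UNIV - {0}. \<psi> (- (b * a))) +
      (2 * l * W + W * W) * (\<Sum>b\<in>UNIV - {0}. if b * g \<in> H then \<psi> (- (b * a)) else 0)"
    by (simp add: sum.distrib flip: sum_distrib_left)
  also have "(\<Sum>b\<in>UNIV - {0}. \<psi> (- (b * a))) = - 1"
    using sum_psi[of "- a"] a by (subst (asm) sum.remove[of _ 0]) (simp_all add: psi_0 mult.commute add_eq_0_iff)
  also have "(\<Sum>b\<in>UNIV - {0}. if b * g \<in> H then \<psi> (- (b * a)) else 0) =
      (\<Sum>h\<in>H. \<psi> (- (a / g * h)))"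
  proof -
    have "(\<Sum>b\<in>UNIV - {0}. if b * g \<in> H then \<psi> (- (b * a)) else 0) =
        (\<Sum>b\<in>{b. b * g \<in> H}. \<psi> (- (b * a)))"
      by (rule sum.mono_neutral_cong_right) (use kth_powers_nonzero[of 0 k] in \<open>auto simp: H_def\<close>)
    also have "\<dots> = (\<Sum>h\<in>H. \<psi> (- (a / g * h)))"
      by (rule sum.reindex_bij_witness[of _ "\<lambda>h. h / g" "\<lambda>b. b * g"])
        (use g in \<open>auto simp: mult.commute\<close>)
    finally show ?thesis .
  qed
  also have "\<dots> = l + (if a \<in> H then W else 0)"
    unfolding neg using period[of "a / g"] a g by simp
  also have "?n * ?n + (l * l * - 1 + (2 * l * W + W * W) * (l + (if a \<in> H then W else 0))) =
      W * W * (l * (l + 1) + (if a \<in> H then 2 * l + W else 0))"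
    unfolding n by (simp add: algebra_simps)
  finally have "of_nat (p ^ m) * of_nat (card {(x, y). x \<in> H \<and> y \<in> H \<and> x - y = a}) =
      of_nat (p ^ m) * (l * (l + 1) + (if a \<in> H then 2 * l + W else 0))"
    unfolding W .
  moreover have "of_nat (p ^ m) \<noteq> (0 :: complex)" using q0 by simp
  ultimately show ?thesis unfolding mult_cancel_left by blast
qed

end

section \<open>The sums over \<open>x\<^bsup>P+1\<^esup>\<close> and the semiprimitive periods\<close>

text \<open>
  From here on the field has \<open>P\<^bsup>2s\<^esup>\<close> elements, where \<open>P = p\<^sup>t\<close>. The exponent
  \<open>P + 1\<close> makes \<open>x \<mapsto> x\<^bsup>P+1\<^esup>\<close> a Hermitian form, and \<open>S a\<close> below is the corresponding
  quadratic-type exponential sum. On every \<open>a\<close> it equals \<open>1 + (P + 1) \<eta>\<close>, \<open>\<eta>\<close> being the period of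
  \<open>a\<close> over \<open>H\<close>.
\<close>

locale semiprimitive_field = frobenius_character +
  fixes t s :: nat
  assumes m_eq: "m = 2 * t * s" and t_pos: "t > 0"
begin

definition P :: nat where "P = p ^ t"

abbreviation H where "H \<equiv> kth_powers (P + 1) :: 'a set"

definition S :: "'a \<Rightarrow> complex" where "S a = (\<Sum>x\<in>UNIV. \<psi> (a * x ^ (P + 1)))"

lemma P_ge_2: "P \<ge> 2"
proof -
  have "p ^ 1 \<le> p ^ t" using p_gt_1 t_pos by (intro power_increasing) auto
  then show ?thesis using p_gt_1 by (simp add: P_def)
qed

lemma q_eq: "p ^ m = P ^ s * P ^ s"
proof -
  have "m = t * s + t * s" by (simp add: m_eq)
  then show ?thesis by (simp only: P_def power_add power_mult)
qed

lemma q_minus_1: obtains j where "p ^ m - 1 = (P - 1) * (P + 1) * j"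
proof -
  have *: "x - 1 dvd x ^ n - 1" if "x > 0" for x n :: nat
  proof (induction n)
    case (Suc n)
    have "x ^ Suc n - 1 = x * (x ^ n - 1) + (x - 1)"
      using that by (simp add: diff_mult_distrib2)
    then show ?case using Suc by (metis dvd_add dvd_mult dvd_refl)
  qed simp
  have "P * P - 1 dvd (P * P) ^ s - 1" using P_ge_2 by (intro *) simp
  then have "(P - 1) * (P + 1) dvd p ^ m - 1"
    by (simp add: q_eq power_mult_distrib algebra_simps diff_mult_distrib)
  then show ?thesis using that by (auto elim: dvdE)
qed

lemma dvd_q_minus_1: "P + 1 dvd p ^ m - 1" "P - 1 dvd p ^ m - 1" "P * P - 1 dvd p ^ m - 1"
proof -
  obtain j where j: "p ^ m - 1 = (P - 1) * (P + 1) * j" by (rule q_minus_1)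
  have "P * P - 1 = (P - 1) * (P + 1)" by (simp add: algebra_simps diff_mult_distrib)
  then show "P * P - 1 dvd p ^ m - 1"
    unfolding j by (simp only: dvd_triv_left)
  show "P + 1 dvd p ^ m - 1" "P - 1 dvd p ^ m - 1"
    unfolding j by (rule dvd_mult2, rule dvd_triv_right, rule dvd_mult2, rule dvd_triv_left)
qed

lemma minus_one_power:
  assumes "odd p \<Longrightarrow> even i"
  shows "(- 1 :: 'a) ^ i = 1"
proof (cases "odd p")
  case True
  then show ?thesis using assms by simp
next
  case False
  then have "p = 2" using prime_p primes_dvd_imp_eq two_is_prime_nat by blast
  then have "(of_nat 2 :: 'a) = 0" using char_p of_nat_CHAR by metis
  then have "(- 1 :: 'a) = - 1 + 2" by simp
  also have "\<dots> = 1" by simp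
  finally have "(- 1 :: 'a) = 1" .
  then show ?thesis by (simp only: power_one)
qed

lemma minus_one_in_H: "- 1 \<in> H"
proof -
  obtain j where j: "p ^ m - 1 = (P - 1) * (P + 1) * j" by (rule q_minus_1)
  have "(p ^ m - 1) div (P + 1) = (P - 1) * j"
    unfolding j mult.commute[of "P - 1" "P + 1"] mult.assoc
    by (intro nonzero_mult_div_cancel_left) simp
  moreover have "(- 1 :: 'a) ^ ((P - 1) * j) = 1"
    by (rule minus_one_power) (use P_ge_2 in \<open>auto simp: P_def\<close>)
  ultimately show ?thesis
    using kth_powers_eq_roots[of "P + 1", where 'a='a] dvd_q_minus_1(1) unfolding card_field by simp
qed

lemma ex_root_minus_one: "\<exists>x0 :: 'a. x0 \<noteq> 0 \<and> x0 ^ (P - 1) = - 1"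
proof -
  obtain j where j: "p ^ m - 1 = (P - 1) * (P + 1) * j" by (rule q_minus_1)
  have "(p ^ m - 1) div (P - 1) = (P + 1) * j"
    unfolding j mult.assoc using P_ge_2 by (intro nonzero_mult_div_cancel_left) simp
  moreover have "(- 1 :: 'a) ^ ((P + 1) * j) = 1"
    by (rule minus_one_power) (auto simp: P_def)
  ultimately have "- 1 \<in> (kth_powers (P - 1) :: 'a set)"
    using kth_powers_eq_roots[of "P - 1", where 'a='a] dvd_q_minus_1(2) unfolding card_field by simp
  then show ?thesis unfolding kth_powers_def by (auto dest: sym)
qed

lemma root_of_unity_in_H:
  assumes "(u :: 'a) ^ (P - 1) = 1"
  shows "u \<in> H"
proof -
  obtain j where j: "p ^ m - 1 = (P - 1) * (P + 1) * j" by (rule q_minus_1)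
  have "(p ^ m - 1) div (P + 1) = (P - 1) * j"
    unfolding j mult.commute[of "P - 1" "P + 1"] mult.assoc
    by (intro nonzero_mult_div_cancel_left) simp
  then show ?thesis
    using kth_powers_eq_roots[of "P + 1", where 'a='a] dvd_q_minus_1(1) assms unfolding card_field
    by (simp add: power_mult)
qed

text \<open>On the kernel of \<open>z \<mapsto> z\<^sup>P + z\<close> the trace vanishes, since \<open>m\<close> is a multiple of \<open>2 t\<close>.\<close>

lemma psi_eq_1:
  assumes "(z :: 'a) ^ P = - z"
  shows "\<psi> z = 1"
proof (rule psi_trace_0)
  let ?g = "\<lambda>i. z ^ (p ^ i)"
  have neg: "(- x) ^ (p ^ i) = - (x ^ (p ^ i))" for x :: 'a and i
  proof -
    have "0 = (x + (- x)) ^ (p ^ i)" using p_gt_1 by simp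
    also have "\<dots> = x ^ (p ^ i) + (- x) ^ (p ^ i)"
      using prime_p char_p by (intro freshmans_dream') auto
    finally show ?thesis by (simp add: eq_neg_iff_add_eq_0 add.commute)
  qed
  have shift: "?g (i + t) = - ?g i" for i
  proof -
    have "?g (i + t) = (z ^ P) ^ (p ^ i)" by (simp add: P_def power_add mult.commute flip: power_mult)
    then show ?thesis unfolding assms neg .
  qed
  have block: "(\<Sum>i<r + 2 * t. ?g i) = (\<Sum>i<r. ?g i)" for r
  proof -
    have app: "(\<Sum>i<a + b. ?g i) = (\<Sum>i<a. ?g i) + (\<Sum>i<b. ?g (a + i))" for a b
      by (induction b) (simp_all add: add.assoc)
    have "(\<Sum>i<r + t + t. ?g i) =
        (\<Sum>i<r. ?g i) + (\<Sum>i<t. ?g (r + i)) + (\<Sum>i<t. ?g (r + t + i))"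
      by (simp only: app)
    also have "(\<Sum>i<t. ?g (r + t + i)) = (\<Sum>i<t. - ?g (r + i))"
    proof (rule sum.cong)
      fix i
      have "?g (r + t + i) = ?g ((r + i) + t)" by (simp only: ac_simps)
      then show "?g (r + t + i) = - ?g (r + i)" unfolding shift .
    qed simp
    finally show ?thesis by (simp add: sum_negf mult_2 add.assoc)
  qed
  have "(\<Sum>i<2 * t * r. ?g i) = 0" for r
  proof (induction r)
    case (Suc r)
    then show ?case using block[of "2 * t * r"] by (simp add: add.commute)
  qed simp
  then show "field_trace p m z = 0" unfolding field_trace_def m_eq by blast
qed

lemma S_mult_H:
  assumes "h \<in> H"
  shows "S (a * h) = S a"
proof -
  obtain y where y: "y \<noteq> 0" "h = y ^ (P + 1)" using assms unfolding kth_powers_def by blast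
  have "S (a * h) = (\<Sum>x\<in>UNIV. \<psi> (a * (y * x) ^ (P + 1)))"
    by (simp only: S_def y power_mult_distrib mult.assoc)
  also have "\<dots> = S a" unfolding S_def
    by (rule sum.reindex_bij_witness[of _ "\<lambda>x. x / y" "\<lambda>x. y * x"]) (use y in auto)
  finally show ?thesis .
qed

lemma S_uminus: "S (- a) = S a"
  using S_mult_H[OF minus_one_in_H, of a] by simp

lemma sum_psi_power_P: "(\<Sum>x\<in>UNIV. \<psi> (c * x ^ P)) = (if c = 0 then of_nat (p ^ m) else 0)"
proof -
  have "inj (\<lambda>x :: 'a. x ^ P)"
  proof (rule injI)
    fix x y :: 'a assume eq: "x ^ P = y ^ P"
    have "x ^ P = ((x - y) + y) ^ P" by simp
    also have "\<dots> = (x - y) ^ P + y ^ P"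
      using prime_p char_p by (intro freshmans_dream'[where n = t]) (auto simp: P_def)
    finally show "x = y" using eq P_ge_2 by simp
  qed
  then have "bij (\<lambda>x :: 'a. x ^ P)" by (simp add: bij_def finite_UNIV_inj_surj)
  then have "(\<Sum>x\<in>UNIV. \<psi> (c * x ^ P)) = (\<Sum>x\<in>UNIV. \<psi> (c * x))"
    by (rule sum.reindex_bij_betw)
  then show ?thesis using sum_psi by simp
qed

text \<open>
  The square of \<open>S a\<close>: expanding \<open>(x + y)\<^bsup>P+1\<^esup>\<close> as a Hermitian form, the sum over \<open>x\<close>
  vanishes unless \<open>y\<close> lies in the radical \<open>a y + a\<^sup>P y\<^bsup>P\<^sup>2\<^esup> = 0\<close>.
\<close>

lemma S_square:
  "S a * S a = of_nat (p ^ m) * of_nat (card {y. a * y + a ^ P * y ^ (P * P) = 0})"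
proof -
  have expand: "a * (x + y) ^ (P + 1) - a * x ^ (P + 1) =
      a * y ^ (P + 1) + (a * y * x ^ P + a * y ^ P * x)" for x y
  proof -
    have "(x + y) ^ P = x ^ P + y ^ P"
      using prime_p char_p by (intro freshmans_dream'[where n = t]) (auto simp: P_def)
    then show ?thesis by (simp add: algebra_simps)
  qed
  have frob: "\<psi> (a * y ^ P * x) = \<psi> (a ^ P * y ^ (P * P) * x ^ P)" for x y
    using psi_frobenius_power[of "a * y ^ P * x" t]
    by (simp add: P_def power_mult_distrib flip: power_mult)
  have inner: "(\<Sum>x\<in>UNIV. \<psi> (a * (x + y) ^ (P + 1) - a * x ^ (P + 1))) =
      (if a * y + a ^ P * y ^ (P * P) = 0 then of_nat (p ^ m) else 0)" for y
  proof -
    have "(\<Sum>x\<in>UNIV. \<psi> (a * (x + y) ^ (P + 1) - a * x ^ (P + 1))) =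
        \<psi> (a * y ^ (P + 1)) * (\<Sum>x\<in>UNIV. \<psi> (a * y * x ^ P) * \<psi> (a * y ^ P * x))"
      unfolding expand psi_add by (simp add: sum_distrib_left)
    also have "(\<Sum>x\<in>UNIV. \<psi> (a * y * x ^ P) * \<psi> (a * y ^ P * x)) =
        (\<Sum>x\<in>UNIV. \<psi> ((a * y + a ^ P * y ^ (P * P)) * x ^ P))"
      unfolding frob by (simp add: distrib_right flip: psi_add)
    also have "\<dots> = (if a * y + a ^ P * y ^ (P * P) = 0 then of_nat (p ^ m) else 0)"
      by (rule sum_psi_power_P)
    also have "\<psi> (a * y ^ (P + 1)) * \<dots> = \<dots>"
    proof (cases "a * y + a ^ P * y ^ (P * P) = 0")
      case True
      have "(a * y ^ (P + 1)) ^ P = (a ^ P * y ^ (P * P)) * y ^ P"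
        by (simp add: power_mult_distrib power_add algebra_simps flip: power_mult)
      also have "a ^ P * y ^ (P * P) = - (a * y)" using True by (simp add: add_eq_0_iff)
      finally have "\<psi> (a * y ^ (P + 1)) = 1" by (intro psi_eq_1) (simp add: mult_ac)
      then show ?thesis by simp
    qed simp
    finally show ?thesis .
  qed
  have "S a * S a = S a * S (- a)" by (simp add: S_uminus)
  also have "\<dots> = (\<Sum>z\<in>UNIV. \<Sum>x\<in>UNIV. \<psi> (a * z ^ (P + 1) - a * x ^ (P + 1)))"
    unfolding S_def sum_product psi_add[symmetric] by simp
  also have "\<dots> = (\<Sum>x\<in>UNIV. \<Sum>z\<in>UNIV. \<psi> (a * z ^ (P + 1) - a * x ^ (P + 1)))"
    by (rule sum.swap)
  also have "\<dots> = (\<Sum>x\<in>UNIV. \<Sum>y\<in>UNIV. \<psi> (a * (x + y) ^ (P + 1) - a * x ^ (P + 1)))"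
  proof (rule sum.cong)
    fix x
    show "(\<Sum>z\<in>UNIV. \<psi> (a * z ^ (P + 1) - a * x ^ (P + 1))) =
        (\<Sum>y\<in>UNIV. \<psi> (a * (x + y) ^ (P + 1) - a * x ^ (P + 1)))"
      by (rule sum.reindex_bij_witness[of _ "\<lambda>y. x + y" "\<lambda>z. z - x"]) auto
  qed simp
  also have "\<dots> = (\<Sum>y\<in>UNIV. \<Sum>x\<in>UNIV. \<psi> (a * (x + y) ^ (P + 1) - a * x ^ (P + 1)))"
    by (rule sum.swap)
  also have "\<dots> = of_nat (p ^ m) * of_nat (card {y. a * y + a ^ P * y ^ (P * P) = 0})"
    unfolding inner by (simp add: sum.If_cases Int_def)
  finally show ?thesis .
qed

text \<open>
  A nonzero \<open>y\<close> lies in the radical iff \<open>(a y\<^bsup>P+1\<^esup>)\<^bsup>P-1\<^esup> = - 1\<close>, which is solvable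
  exactly when \<open>a\<close> lies in the coset \<open>x0 H\<close>; the radical is then a line over the field with
  \<open>P\<^sup>2\<close> elements.
\<close>

lemma card_radical:
  assumes a: "a \<noteq> 0" and x0: "x0 \<noteq> 0" "x0 ^ (P - 1) = - 1"
  shows "card {y. a * y + a ^ P * y ^ (P * P) = 0} = (if a * inverse x0 \<in> H then P * P else 1)"
proof -
  have PP: "P * P = Suc (P * P - 1)" "P = Suc (P - 1)" using P_ge_2 by auto
  have e: "(P + 1) * (P - 1) = P * P - 1" by (simp add: algebra_simps diff_mult_distrib)
  have iff: "a * y + a ^ P * y ^ (P * P) = 0 \<longleftrightarrow> (a * y ^ (P + 1)) ^ (P - 1) = - 1" if "y \<noteq> 0" for y
  proof -
    have "a * y + a ^ P * y ^ (P * P) = a * y * (1 + a ^ (P - 1) * y ^ (P * P - 1))"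
      by (subst (1) PP(1), subst (1) PP(2)) (simp add: algebra_simps)
    also have "a ^ (P - 1) * y ^ (P * P - 1) = (a * y ^ (P + 1)) ^ (P - 1)"
      by (simp only: power_mult_distrib power_mult[symmetric] e)
    finally show ?thesis using a that by (simp add: add_eq_0_iff)
  qed
  have zero: "a * 0 + a ^ P * 0 ^ (P * P) = 0" using P_ge_2 by (simp add: power_0_left)
  show ?thesis
  proof (cases "a * inverse x0 \<in> H")
    case True
    then obtain h where h: "h \<noteq> 0" "a * inverse x0 = h ^ (P + 1)" unfolding kth_powers_def by blast
    define y0 where "y0 = inverse h"
    have y0: "y0 \<noteq> 0" "a * y0 ^ (P + 1) = x0"
      using h x0(1) a unfolding y0_def power_inverse by (auto simp: field_simps)
    have eq: "a * y + a ^ P * y ^ (P * P) = 0 \<longleftrightarrow> y ^ (P * P - 1) = y0 ^ (P * P - 1)" if "y \<noteq> 0" for y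
    proof -
      have pw: "(a * z ^ (P + 1)) ^ (P - 1) = a ^ (P - 1) * z ^ (P * P - 1)" for z
        by (simp only: power_mult_distrib power_mult[symmetric] e)
      have y0': "a ^ (P - 1) * y0 ^ (P * P - 1) = - 1" unfolding pw[symmetric] y0(2) by (rule x0(2))
      have "a ^ (P - 1) \<noteq> 0" using a by simp
      then show ?thesis unfolding iff[OF that] pw y0'[symmetric] mult_cancel_left by blast
    qed
    have set: "{y. a * y + a ^ P * y ^ (P * P) = 0} = insert 0 {y. y ^ (P * P - 1) = y0 ^ (P * P - 1)}"
    proof (rule set_eqI)
      fix y
      show "y \<in> {y. a * y + a ^ P * y ^ (P * P) = 0} \<longleftrightarrow>
          y \<in> insert 0 {y. y ^ (P * P - 1) = y0 ^ (P * P - 1)}"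
      proof (cases "y = 0")
        case True
        then show ?thesis using zero by simp
      next
        case False
        then show ?thesis using eq[OF False] by simp
      qed
    qed
    have "card (insert 0 {y. y ^ (P * P - 1) = y0 ^ (P * P - 1)}) =
        Suc (card {y. y ^ (P * P - 1) = y0 ^ (P * P - 1)})"
    proof (rule card_insert_disjoint)
      have "2 * 2 \<le> P * P" using P_ge_2 by (intro mult_mono) auto
      then have "0 < P * P - 1" by simp
      then show "0 \<notin> {y. y ^ (P * P - 1) = y0 ^ (P * P - 1)}"
        using y0 by (simp add: power_0_left)
    qed simp
    also have "\<dots> = P * P"
      using card_kth_power_fibre[OF y0(1), of "P * P - 1"] card_power_eq_1[of "P * P - 1", where 'a='a]
        dvd_q_minus_1(3) PP(1) unfolding card_field by simp
    finally show ?thesis unfolding set using True by simp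
  next
    case False
    have nz: "a * y + a ^ P * y ^ (P * P) \<noteq> 0" if y: "y \<noteq> 0" for y
    proof
      assume "a * y + a ^ P * y ^ (P * P) = 0"
      then have "(a * y ^ (P + 1)) ^ (P - 1) = x0 ^ (P - 1)" unfolding iff[OF y] x0 .
      then have "(a * y ^ (P + 1) * inverse x0) ^ (P - 1) = x0 ^ (P - 1) * inverse x0 ^ (P - 1)"
        by (simp only: power_mult_distrib[of _ "inverse x0"])
      also have "\<dots> = 1" unfolding power_mult_distrib[symmetric] using x0(1) by simp
      finally have "a * y ^ (P + 1) * inverse x0 \<in> H" by (rule root_of_unity_in_H)
      then have "y ^ (P + 1) * (a * inverse x0) \<in> H"
        by (simp only: mult.left_commute[of "y ^ (P + 1)"] mult.assoc)
      moreover have "y ^ (P + 1) \<in> H" using y by (rule kth_powersI)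
      ultimately show False using False kth_powers_mult_iff[of "y ^ (P + 1)" "P + 1" "a * inverse x0"] by simp
    qed
    have "{y. a * y + a ^ P * y ^ (P * P) = 0} = {0}"
    proof (rule set_eqI)
      fix y
      show "y \<in> {y. a * y + a ^ P * y ^ (P * P) = 0} \<longleftrightarrow> y \<in> {0}"
      proof (cases "y = 0")
        case True
        then show ?thesis using zero by simp
      next
        case False
        then show ?thesis using nz[OF False] by simp
      qed
    qed
    then show ?thesis using False by simp
  qed
qed

lemma sum_S: "(\<Sum>a\<in>UNIV - {0}. S a) = 0"
proof -
  have "(\<Sum>a\<in>UNIV. S a) = (\<Sum>x\<in>UNIV. \<Sum>a\<in>UNIV. \<psi> (x ^ (P + 1) * a))"
    unfolding S_def by (subst sum.swap) (simp add: mult.commute)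
  also have "\<dots> = (\<Sum>x\<in>UNIV. if (x :: 'a) = 0 then of_nat (p ^ m) else 0)"
    unfolding sum_psi by (rule sum.cong) auto
  also have "\<dots> = of_nat (p ^ m)" by simp
  finally have "S 0 + (\<Sum>a\<in>UNIV - {0}. S a) = of_nat (p ^ m)"
    by (subst (asm) sum.remove[of _ 0]) simp_all
  moreover have "S 0 = of_nat (p ^ m)" by (simp add: S_def psi_0 card_field)
  ultimately show ?thesis by simp
qed

lemma card_H: "card H * (P + 1) = p ^ m - 1"
proof -
  have "card H = (p ^ m - 1) div (P + 1)"
    using card_kth_powers[of "P + 1", where 'a='a] dvd_q_minus_1(1) unfolding card_field by blast
  then show ?thesis using dvd_q_minus_1(1) by (simp only: dvd_div_mult_self)
qed

text \<open>
  The values of \<open>S\<close>: on one coset of \<open>H\<close> the modulus is \<open>P w\<close>, on the other \<open>P\<close> cosets it is \<open>w\<close>.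
  As the values over all cosets add up to zero, the latter must all be equal, of sign opposite to
  the former.
\<close>

lemma S_values:
  obtains g :: 'a and \<delta> :: real where "g \<noteq> 0" "\<delta> = 1 \<or> \<delta> = - 1"
    "\<And>a. a \<noteq> 0 \<Longrightarrow> S a = complex_of_real \<delta> * of_nat (P ^ s) * (if a * g \<in> H then of_nat P else - 1)"
proof -
  obtain x0 :: 'a where x0: "x0 \<noteq> 0" "x0 ^ (P - 1) = - 1" using ex_root_minus_one by blast
  \<comment> \<open>The exceptional coset is \<open>x0 H\<close>; it is described as \<open>{a. a * g \<in> H}\<close>.\<close>
  define g where "g = inverse x0"
  define w where "w = real (P ^ s)"
  have w0: "w > 0" using P_ge_2 by (simp add: w_def)
  have g0: "g \<noteq> 0" using x0 by (simp add: g_def)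
  have sq: "S a * S a = (of_real w * (if a * g \<in> H then of_nat P else 1)) ^ 2" if "a \<noteq> 0" for a
    unfolding S_square card_radical[OF that x0] q_eq g_def w_def by (simp add: power2_eq_square)
  have pm: "S a = of_real w * (if a * g \<in> H then of_nat P else 1) \<or>
      S a = - (of_real w * (if a * g \<in> H then of_nat P else 1))" if "a \<noteq> 0" for a
    using sq[OF that] by (metis power2_eq_iff power2_eq_square)
  have x0g: "x0 * g \<in> H" using x0 kth_powers_one by (simp add: g_def)
  obtain \<delta> :: real where d: "\<delta> = 1 \<or> \<delta> = - 1" "S x0 = \<delta> * of_real w * of_nat P"
  proof -
    from pm[OF x0(1)] x0g consider "S x0 = of_real w * of_nat P" | "S x0 = - (of_real w * of_nat P)"
      by auto
    then show thesis
    proof cases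
      case 1
      then show ?thesis by (intro that[of 1]) simp_all
    next
      case 2
      then show ?thesis by (intro that[of "- 1"]) simp_all
    qed
  qed
  have dd: "\<delta> * \<delta> = 1" using d(1) by auto
  have on: "S a = \<delta> * of_real w * of_nat P" if "a * g \<in> H" for a
  proof -
    have a: "x0 * (a * g) = a" using x0(1) by (simp add: g_def)
    show ?thesis using S_mult_H[OF that, of x0] unfolding a d(2) .
  qed
  let ?T = "{a \<in> UNIV - {0}. a * g \<notin> H}"
  have cardD: "card {a. a * g \<in> H} = card H"
    by (rule bij_betw_same_card[of "\<lambda>a. a * g"], rule bij_betwI[of _ _ _ "\<lambda>h. h / g"])
       (use g0 in auto)
  have split: "UNIV - {0} = {a. a * g \<in> H} \<union> ?T"
    using kth_powers_nonzero[of 0 "P + 1"] by auto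
  have cardT: "card ?T = card H * P"
  proof -
    have "card (UNIV - {0 :: 'a}) = card {a. a * g \<in> H} + card ?T"
      by (subst split, rule card_Un_disjoint) auto
    then show ?thesis using card_H cardD card_field by simp
  qed
  have "0 = (\<Sum>a\<in>{a. a * g \<in> H}. S a) + (\<Sum>a\<in>?T. S a)"
    unfolding sum_S[symmetric] by (subst split, rule sum.union_disjoint) auto
  also have "(\<Sum>a\<in>{a. a * g \<in> H}. S a) = of_nat (card H) * (\<delta> * of_real w * of_nat P)"
    using on cardD by simp
  finally have "(\<Sum>a\<in>?T. S a) = - (of_nat (card H) * (\<delta> * of_real w * of_nat P))"
    by (simp add: eq_neg_iff_add_eq_0 add.commute)
  then have "\<delta> * (\<Sum>a\<in>?T. S a) = - (complex_of_real (\<delta> * \<delta>) * of_nat (card H * P) * of_real w)"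
    by (simp add: algebra_simps)
  then have "(\<Sum>a\<in>?T. \<delta> * S a + of_real w) = 0"
    using cardT dd by (simp add: sum.distrib sum_distrib_left)
  \<comment> \<open>Each summand is \<open>0\<close> or \<open>2 w\<close>, so all of them vanish.\<close>
  then have "(\<Sum>a\<in>?T. Re (\<delta> * S a + of_real w)) = 0"
    by (metis Re_sum zero_complex.simps(1))
  moreover have val: "S a = of_real w \<or> S a = - of_real w" if "a \<in> ?T" for a
    using pm[of a] that by simp
  then have "0 \<le> Re (\<delta> * S a + of_real w)" if "a \<in> ?T" for a
    using val[OF that] d(1) w0 by auto
  ultimately have zero: "Re (\<delta> * S a + of_real w) = 0" if "a \<in> ?T" for a
    using that by (subst (asm) sum_nonneg_eq_0_iff) auto
  have off: "S a = - \<delta> * of_real w" if "a \<in> ?T" for a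
    using zero[OF that] val[OF that] d(1) w0 by auto
  show ?thesis
  proof (rule that[OF g0 d(1)])
    fix a :: 'a assume "a \<noteq> 0"
    then show "S a = complex_of_real \<delta> * of_nat (P ^ s) * (if a * g \<in> H then of_nat P else - 1)"
      using on[of a] off[of a] by (simp add: w_def)
  qed
qed

lemma H_subset:
  assumes "k dvd P + 1"
  shows "H \<subseteq> kth_powers k"
proof
  fix x assume "x \<in> H"
  then obtain y where y: "y \<noteq> 0" "x = y ^ (P + 1)" unfolding kth_powers_def by blast
  obtain j where "P + 1 = k * j" using assms by (rule dvdE)
  then have "x = (y ^ j) ^ k" using y by (simp only: power_mult[symmetric] mult.commute)
  then show "x \<in> kth_powers k" using kth_powersI[of "y ^ j" k] y(1) by simp
qed

text \<open>
  The periods over the \<open>k\<close>-th powers for all \<open>k\<close> dividing \<open>P + 1\<close>, obtained by averaging \<open>S\<close>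
  over a coset of the \<open>k\<close>-th powers.
\<close>

lemma period_values_upto_sign:
  obtains g :: 'a and \<delta> :: real where "g \<noteq> 0" "\<delta> = 1 \<or> \<delta> = - 1"
    "\<And>k b. k dvd P + 1 \<Longrightarrow> b \<noteq> 0 \<Longrightarrow> (\<Sum>h\<in>kth_powers k. \<psi> (b * h)) =
       - (complex_of_real \<delta> * of_nat (P ^ s) + 1) / of_nat k + (if b * g \<in> kth_powers k then complex_of_real \<delta> * of_nat (P ^ s) else 0)"
proof -
  obtain g :: 'a and \<delta> :: real where g: "g \<noteq> 0" and d: "\<delta> = 1 \<or> \<delta> = - 1"
    and Sv: "\<And>a. a \<noteq> 0 \<Longrightarrow> S a = complex_of_real \<delta> * of_nat (P ^ s) * (if a * g \<in> H then of_nat P else - 1)"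
    by (rule S_values) (rule that; (assumption | simp only:))
  define W :: complex where "W = complex_of_real \<delta> * of_nat (P ^ s)"
  have "(\<Sum>h\<in>kth_powers k. \<psi> (b * h)) =
      - (W + 1) / of_nat k + (if b * g \<in> kth_powers k then W else 0)"
    if k: "k dvd P + 1" and b: "b \<noteq> 0" for k b
  proof -
    let ?H = "kth_powers k :: 'a set"
    have kq: "k dvd p ^ m - 1" using k dvd_q_minus_1(1) by (rule dvd_trans)
    have k0: "k > 0" using k by (auto intro: Nat.gr0I)
    have q1: "p ^ m - 1 > 0" using card_field_gt_1[where 'a='a] card_field by simp
    have nk: "k * card ?H = p ^ m - 1"
      using card_kth_powers[of k, where 'a='a] kq unfolding card_field by simp
    let ?Q = "of_nat (p ^ m - 1) :: complex"
    have Sv': "S a = - W + (if a * g \<in> H then of_nat (P + 1) * W else 0)" if "a \<noteq> 0" for a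
      using Sv[OF that] by (simp add: W_def algebra_simps)
    have inner: "(\<Sum>h\<in>?H. \<psi> (b * h * x ^ (P + 1))) = (\<Sum>h\<in>?H. \<psi> (b * h))" if "x \<noteq> 0" for x
    proof -
      have "x ^ (P + 1) \<in> H" using that by (rule kth_powersI)
      then have "x ^ (P + 1) \<in> ?H" using H_subset[OF k] by blast
      from period_mult_kth_power[OF this, of "\<lambda>h. \<psi> (b * h)"] show ?thesis
        by (simp only: mult_ac)
    qed
    have "(\<Sum>h\<in>?H. S (b * h)) = (\<Sum>x\<in>UNIV. \<Sum>h\<in>?H. \<psi> (b * h * x ^ (P + 1)))"
      unfolding S_def by (rule sum.swap)
    also have "\<dots> = of_nat (card ?H) + (\<Sum>x\<in>UNIV - {0}. \<Sum>h\<in>?H. \<psi> (b * h * x ^ (P + 1)))"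
      by (subst sum.remove[of _ 0]) (simp_all add: psi_0)
    also have "\<dots> = of_nat (card ?H) + ?Q * (\<Sum>h\<in>?H. \<psi> (b * h))"
      using inner card_field by simp
    finally have lhs: "(\<Sum>h\<in>?H. S (b * h)) = of_nat (card ?H) + ?Q * (\<Sum>h\<in>?H. \<psi> (b * h))" .
    have "(\<Sum>h\<in>?H. S (b * h)) =
        (\<Sum>h\<in>?H. - W + (if b * g * h \<in> H then of_nat (P + 1) * W else 0))"
    proof (rule sum.cong)
      fix h assume "h \<in> ?H"
      then show "S (b * h) = - W + (if b * g * h \<in> H then of_nat (P + 1) * W else 0)"
        using Sv'[of "b * h"] b kth_powers_nonzero by (metis mult.assoc mult.commute no_zero_divisors)
    qed simp
    also have "\<dots> = - of_nat (card ?H) * W + of_nat (card {h \<in> ?H. b * g * h \<in> H}) * (of_nat (P + 1) * W)"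
      unfolding sum.distrib by (simp add: sum.If_cases Int_def)
    also have "card {h \<in> ?H. b * g * h \<in> H} = (if b * g \<in> ?H then card H else 0)"
    proof (cases "b * g \<in> ?H")
      case True
      define c where "c = b * g"
      have c: "c \<noteq> 0" "c \<in> ?H" using b g True by (simp_all add: c_def)
      have "bij_betw (\<lambda>h. c * h) {h \<in> ?H. c * h \<in> H} H"
      proof (rule bij_betwI[of _ _ _ "\<lambda>h. inverse c * h"])
        show "(\<lambda>h. inverse c * h) \<in> H \<rightarrow> {h \<in> ?H. c * h \<in> H}"
        proof
          fix h assume h: "h \<in> H"
          then have "inverse c * h \<in> ?H"
            using H_subset[OF k] c(2) by (blast intro: kth_powers_mult kth_powers_inverse)
          then show "inverse c * h \<in> {h \<in> ?H. c * h \<in> H}"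
            using h c(1) by (simp flip: mult.assoc)
        qed
      qed (use c(1) in \<open>auto simp flip: mult.assoc\<close>)
      then have "card {h \<in> ?H. c * h \<in> H} = card H" by (rule bij_betw_same_card)
      then show ?thesis using True unfolding c_def by simp
    next
      case False
      have "b * g * h \<notin> H" if "h \<in> ?H" for h
        using H_subset[OF k] False kth_powers_mult_iff[OF that, of "b * g"] by (auto simp: mult.commute)
      then have "{h \<in> ?H. b * g * h \<in> H} = {}" by blast
      then show ?thesis using False by simp
    qed
    also have "of_nat \<dots> * (of_nat (P + 1) * W) = ?Q * (if b * g \<in> ?H then W else 0)"
      unfolding card_H[symmetric] by (simp add: distrib_left)
    finally have "of_nat (card ?H) + ?Q * (\<Sum>h\<in>?H. \<psi> (b * h)) =
        - of_nat (card ?H) * W + ?Q * (if b * g \<in> ?H then W else 0)"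
      unfolding lhs .
    then have "?Q * (\<Sum>h\<in>?H. \<psi> (b * h)) =
        - of_nat (card ?H) * (W + 1) + ?Q * (if b * g \<in> ?H then W else 0)"
      by (simp add: algebra_simps eq_diff_eq)
    also have "of_nat (card ?H) = ?Q / of_nat k"
      unfolding nk[symmetric] using k0 by simp
    also have "- (?Q / of_nat k) * (W + 1) + ?Q * (if b * g \<in> ?H then W else 0) =
        ?Q * (- (W + 1) / of_nat k + (if b * g \<in> ?H then W else 0))"
    proof -
      have "- (a / c) * v + a * y = a * (- v / c + y)" for a c v y :: complex
        by (simp add: right_diff_distrib)
      then show ?thesis .
    qed
    finally have "?Q * (\<Sum>h\<in>?H. \<psi> (b * h)) =
        ?Q * (- (W + 1) / of_nat k + (if b * g \<in> ?H then W else 0))" .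
    moreover have "?Q \<noteq> 0" using q1 unfolding of_nat_eq_0_iff by simp
    ultimately show ?thesis unfolding mult_cancel_left by blast
  qed
  then show ?thesis using that[OF g d] unfolding W_def by blast
qed

text \<open>
  For \<open>k = P + 1\<close> the number of representations in \<open>difference_count\<close> is \<open>l (l + 1)\<close> with
  \<open>l = - (\<delta> w + 1) / (P + 1)\<close>; being an integer, it forces \<open>l\<close> to be an integer, which determines the
  sign \<open>\<delta>\<close>.
\<close>

lemma period_values:
  obtains g :: 'a where "g \<noteq> 0"
    "\<And>k b. k dvd P + 1 \<Longrightarrow> b \<noteq> 0 \<Longrightarrow> (\<Sum>h\<in>kth_powers k. \<psi> (b * h)) =
       - ((- 1) ^ (s + 1) * of_nat (P ^ s) + 1) / of_nat k +
       (if b * g \<in> kth_powers k then (- 1) ^ (s + 1) * of_nat (P ^ s) else 0)"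
proof -
  obtain g :: 'a and \<delta> :: real where g: "g \<noteq> 0" and d: "\<delta> = 1 \<or> \<delta> = - 1"
    and pv: "\<And>k b. k dvd P + 1 \<Longrightarrow> b \<noteq> 0 \<Longrightarrow> (\<Sum>h\<in>kth_powers k. \<psi> (b * h)) =
       - (complex_of_real \<delta> * of_nat (P ^ s) + 1) / of_nat k + (if b * g \<in> kth_powers k then complex_of_real \<delta> * of_nat (P ^ s) else 0)"
    by (rule period_values_upto_sign) (rule that; (assumption | simp only:))
  obtain i :: int where i: "i = 1 \<or> i = - 1" "\<delta> = of_int i"
    using d by (metis of_int_1 of_int_minus)
  define W where "W = complex_of_real \<delta> * of_nat (P ^ s)"
  let ?M = "of_nat (P + 1) :: complex"
  define l where "l = - (W + 1) / ?M"
  have M0: "?M \<noteq> 0" by (metis Suc_eq_plus1 of_nat_neq_0)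
  then have Ml: "?M * l = - (W + 1)" by (simp add: l_def)
  have "card H < card (UNIV - {0 :: 'a})"
  proof -
    have "card H * 1 < card H * (P + 1)"
      using P_ge_2 card_H card_field card_field_gt_1[where 'a='a]
      by (intro mult_strict_left_mono) (auto intro: Nat.gr0I)
    then have "card H < p ^ m - 1" unfolding card_H by (simp only: mult_1_right)
    then show ?thesis using card_field by simp
  qed
  then have "H \<noteq> UNIV - {0}" by (metis less_irrefl)
  moreover have "H \<subseteq> UNIV - {0}" using kth_powers_nonzero[of 0 "P + 1"] by auto
  ultimately obtain a :: 'a where a: "a \<noteq> 0" "a \<notin> H" by auto
  let ?c = "card {(x, y). x \<in> H \<and> y \<in> H \<and> x - y = a}"
  have "of_nat ?c = l * (l + 1) + (if a \<in> H then 2 * l + W else 0)"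
  proof (rule difference_count[OF dvd_q_minus_1(1) minus_one_in_H g _ Ml _ a(1)])
    show "W * W = of_nat (p ^ m)" using d by (auto simp: W_def q_eq)
    show "(\<Sum>h\<in>H. \<psi> (b * h)) = l + (if b * g \<in> H then W else 0)" if "b \<noteq> 0" for b
      using pv[of "P + 1", OF dvd_refl that] unfolding W_def l_def .
  qed
  then have c: "of_nat ?c = l * (l + 1)" using a by simp
  have "(- (W + 1)) * (- (W + 1) + ?M) = of_nat ?c * ?M ^ 2"
    unfolding c Ml[symmetric] by (simp add: algebra_simps power2_eq_square)
  then have "of_int ((- (i * int (P ^ s) + 1)) * (- (i * int (P ^ s) + 1) + int (P + 1))) =
      (of_int (int ?c * (int (P + 1))\<^sup>2) :: complex)"
    unfolding W_def i(2) by simp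
  then have "(- (i * int (P ^ s) + 1)) * (- (i * int (P ^ s) + 1) + int (P + 1)) =
      int ?c * (int (P + 1))\<^sup>2"
    by (simp only: of_int_eq_iff)
  then have "int (P + 1) dvd - (i * int (P ^ s) + 1)"
    by (rule dvd_of_quadratic) simp
  then have d1: "int (P + 1) dvd i * int P ^ s + 1" by (simp only: dvd_minus_iff of_nat_power)
  have "[int P = - 1] (mod int (P + 1))" by (simp add: cong_iff_dvd_diff add.commute)
  then have "[i * int P ^ s + 1 = i * (- 1) ^ s + 1] (mod int (P + 1))"
    by (intro cong_add cong_mult cong_pow cong_refl)
  then have d2: "int (P + 1) dvd i * (- 1) ^ s + 1" using d1 by (simp add: cong_dvd_iff)
  have small: "\<bar>i * (- 1) ^ s + 1\<bar> < int (P + 1)"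
    using i(1) P_ge_2 by (cases "even s") auto
  have "i * (- 1) ^ s + 1 = 0"
  proof (rule ccontr)
    assume "i * (- 1) ^ s + 1 \<noteq> 0"
    from dvd_imp_le_int[OF this d2] small show False by linarith
  qed
  then have "i = (- 1) ^ (s + 1)" using i(1) by (cases "even s") simp_all
  then have "complex_of_real \<delta> = (- 1) ^ (s + 1)" unfolding i(2) by simp
  then show ?thesis using that[OF g] pv by simp
qed

end

section \<open>Strongly regular graphs of diameter two\<close>

lemma pair_graphD:
  assumes "pair_graph G"
  shows "finite (pverts G)" "(u, v) \<in> parcs G \<Longrightarrow> u \<in> pverts G"
    "(u, v) \<in> parcs G \<Longrightarrow> v \<in> pverts G" "(u, u) \<notin> parcs G"
    "(u, v) \<in> parcs G \<Longrightarrow> (v, u) \<in> parcs G" "wf_digraph (with_proj G)" "graph (with_proj G)"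
proof -
  interpret pair_graph G by fact
  show "finite (pverts G)" by (rule pair_finite_verts)
  show "u \<in> pverts G" "v \<in> pverts G" if "(u, v) \<in> parcs G"
    using that by (auto dest: in_arcsD1 in_arcsD2)
  show "(u, u) \<notin> parcs G" using pair_no_loops by fastforce
  show "(v, u) \<in> parcs G" if "(u, v) \<in> parcs G"
    using that pair_sym_arcs by (auto simp: symmetric_def sym_def)
  show "wf_digraph (with_proj G)" by unfold_locales
  show "graph (with_proj G)" by unfold_locales
qed

lemma pair_graphI:
  assumes "finite (pverts G)" "\<And>u v. (u, v) \<in> parcs G \<Longrightarrow> u \<in> pverts G"
    "\<And>u v. (u, v) \<in> parcs G \<Longrightarrow> v \<in> pverts G" "\<And>u. (u, u) \<notin> parcs G"
    "\<And>u v. (u, v) \<in> parcs G \<Longrightarrow> (v, u) \<in> parcs G"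
  shows "pair_graph G"
proof -
  have "parcs G \<subseteq> pverts G \<times> pverts G" using assms(2,3) by auto
  then have "finite (parcs G)" using assms(1) by (meson finite_SigmaI finite_subset)
  moreover have "symmetric (with_proj G)" using assms(5) by (auto simp: symmetric_def sym_def)
  ultimately show ?thesis
    by unfold_locales (use assms(1-4) in \<open>fastforce+\<close>)
qed

lemma graph_dist_eq_length:
  assumes "wf_digraph (with_proj G)"
    and "pre_digraph.awalk (with_proj G) u p v"
    and "\<And>p'. pre_digraph.awalk (with_proj G) u p' v \<Longrightarrow> length p \<le> length p'"
  shows "graph_dist G u v = ereal (real (length p))"
proof -
  have cost: "wf_digraph.awalk_cost (\<lambda>_. 1) p' = real (length p')" for p' :: "('a \<times> 'a) list"
    by (induction p') (auto simp: wf_digraph.awalk_cost_def[OF assms(1)])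
  show ?thesis
    unfolding graph_dist_def wf_digraph.\<mu>_def[OF assms(1)] cost
    by (rule INF_eqI) (use assms(2,3) in auto)
qed

lemma graph_complement_involutive:
  assumes "pair_graph G"
  shows "graph_complement (graph_complement G) = G"
  using pair_graphD[OF assms] by (auto simp: graph_complement_def intro!: pair_pre_digraph.equality)

text \<open>
  For a strongly regular graph, primitivity amounts to \<open>0 < d < r\<close>: the first inequality makes the
  diameter two, the second one excludes complete multipartite graphs.
\<close>

locale primitive_srg =
  fixes G :: "'a pair_pre_digraph" and v r e d :: nat
  assumes srg: "strongly_regular G v r e d"
    and d_pos: "0 < d" and d_less: "d < r"
begin

abbreviation V where "V \<equiv> pverts G"
abbreviation N where "N \<equiv> neighbours G"

lemma pg: "pair_graph G"
  and card_N: "x \<in> V \<Longrightarrow> card (N x) = r"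
  and card_V: "card V = v"
  and arcs_nonempty: "parcs G \<noteq> {}"
  and not_complete: "\<not> complete_digraph (card V) (with_proj G)"
  and common_adj: "(x, y) \<in> parcs G \<Longrightarrow> card (N x \<inter> N y) = e"
  and common_nonadj: "x \<in> V \<Longrightarrow> y \<in> V \<Longrightarrow> x \<noteq> y \<Longrightarrow> (x, y) \<notin> parcs G \<Longrightarrow> card (N x \<inter> N y) = d"
  using srg pair_graphD(2,3)[of G] unfolding strongly_regular_def regular_graph_def by blast+

lemmas graphD = pair_graphD[OF pg]

lemma finite_V: "finite V" by (rule graphD(1))

lemma N_subset: "N x \<subseteq> V" using graphD by (auto simp: neighbours_def)

lemma finite_N: "finite (N x)" using N_subset finite_V by (rule finite_subset)

lemma mem_N: "z \<in> N x \<longleftrightarrow> (x, z) \<in> parcs G" by (simp add: neighbours_def)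

lemma adj_sym: "(x, y) \<in> parcs G \<longleftrightarrow> (y, x) \<in> parcs G" using graphD by blast

lemma adjacent_pair: obtains x y where "x \<in> V" "y \<in> V" "x \<noteq> y" "(x, y) \<in> parcs G"
proof -
  obtain x y where "(x, y) \<in> parcs G" using arcs_nonempty by auto
  then show ?thesis using that graphD by metis
qed

lemma nonadjacent_pair: obtains x y where "x \<in> V" "y \<in> V" "x \<noteq> y" "(x, y) \<notin> parcs G"
proof (rule ccontr)
  assume "\<not> thesis"
  then have "parcs G = {(x, y). (x, y) \<in> V \<times> V \<and> x \<noteq> y}"
    using that graphD by auto
  then have "complete_digraph (card V) (with_proj G)"
    using graphD(7) by (simp add: complete_digraph_def)
  then show False using not_complete by simp
qed

text \<open>
  The distance, as a natural number. That it agrees with \<open>graph_dist\<close> on vertices uses \<open>0 < d\<close>.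
\<close>

definition D :: "'a \<Rightarrow> 'a \<Rightarrow> nat" where
  "D x y = (if x = y then 0 else if (x, y) \<in> parcs G then 1 else 2)"

lemma D_sym: "D x y = D y x"
  by (auto simp: D_def adj_sym)

lemma common_neighbour:
  assumes "x \<in> V" "y \<in> V" "x \<noteq> y" "(x, y) \<notin> parcs G"
  obtains z where "(x, z) \<in> parcs G" "(z, y) \<in> parcs G"
proof -
  have "N x \<inter> N y \<noteq> {}" using common_nonadj[OF assms] d_pos by auto
  then show ?thesis using that adj_sym by (auto simp: mem_N)
qed

lemma graph_dist_eq_D:
  assumes "x \<in> V" "y \<in> V"
  shows "graph_dist G x y = ereal (real (D x y))"
proof -
  interpret pair_graph G by (rule pg)
  have wf: "wf_digraph (with_proj G)" by (rule graphD)
  have lb: "D x y \<le> length p" if "awalk x p y" for p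
  proof (cases p)
    case Nil
    then show ?thesis using that by (auto simp: awalk_Nil_iff D_def)
  next
    case (Cons a p')
    show ?thesis
    proof (cases p')
      case Nil
      then show ?thesis using that Cons by (auto simp: awalk_Cons_iff awalk_Nil_iff D_def)
    qed (auto simp: Cons D_def)
  qed
  obtain p where p: "awalk x p y" "length p = D x y"
  proof (cases "x = y")
    case True
    then show ?thesis using that[of "[]"] assms by (auto simp: awalk_Nil_iff D_def)
  next
    case xy: False
    show ?thesis
    proof (cases "(x, y) \<in> parcs G")
      case True
      then show ?thesis using that[of "[(x, y)]"] xy assms
        by (auto simp: awalk_Nil_iff awalk_Cons_iff D_def)
    next
      case False
      with xy assms obtain z where "(x, z) \<in> parcs G" "(z, y) \<in> parcs G"
        by (metis common_neighbour)
      then show ?thesis using that[of "[(x, z), (z, y)]"] xy False assms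
        by (auto simp: awalk_Nil_iff awalk_Cons_iff D_def)
    qed
  qed
  show ?thesis
    using graph_dist_eq_length[OF wf p(1)] lb p(2) by simp
qed

lemma graph_diameter_eq_2: "graph_diameter G = 2"
proof -
  obtain a b where ab: "a \<in> V" "b \<in> V" "a \<noteq> b" "(a, b) \<notin> parcs G" by (rule nonadjacent_pair)
  have two: "ereal (real 2) = 2" by simp
  have le: "graph_dist G x y \<le> 2" if "x \<in> V" "y \<in> V" for x y
    unfolding graph_dist_eq_D[OF that] two[symmetric] by (auto simp: D_def)
  have "graph_dist G a b = 2" unfolding graph_dist_eq_D[OF ab(1,2)] using ab by (simp add: D_def)
  then have "2 \<le> graph_diameter G"
    unfolding graph_diameter_def using ab by (metis SUP_upper2 order_refl)
  moreover have "graph_diameter G \<le> 2"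
    unfolding graph_diameter_def by (intro SUP_least le)
  ultimately show ?thesis by (rule antisym[rotated])
qed

lemma connected: "Digraph_Component.connected (with_proj G)"
proof -
  have mk: "mk_symmetric (with_proj G) = G"
    using adj_sym by (auto simp: mk_symmetric_def intro!: pair_pre_digraph.equality)
  interpret pair_graph G by (rule pg)
  have "reachable (with_proj G) x y" if xy: "x \<in> V" "y \<in> V" for x y
  proof (cases "x = y \<or> (x, y) \<in> parcs G")
    case True
    then show ?thesis using xy by (auto intro: reachable_refl reachable_adjI)
  next
    case False
    with xy obtain z where "(x, z) \<in> parcs G" "(z, y) \<in> parcs G"
      by (metis common_neighbour)
    then show ?thesis by (meson reachable_adjI reachable_trans)
  qed
  moreover have "V \<noteq> {}" using adjacent_pair by blast
  ultimately show ?thesis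
    unfolding Digraph_Component.connected_def mk strongly_connected_def by simp
qed

text \<open>The intersection numbers: the number of vertices at distances \<open>j\<close> and \<open>l\<close> from \<open>x\<close> and \<open>y\<close>.\<close>

definition K :: "'a \<Rightarrow> 'a \<Rightarrow> nat \<Rightarrow> nat \<Rightarrow> nat" where
  "K x y j l = card {z \<in> V. D x z = j \<and> D y z = l}"

lemma K_sym: "K x y j l = K y x l j"
  unfolding K_def by (rule arg_cong[where f = card]) auto

lemma K_0:
  assumes "x \<in> V"
  shows "K x y 0 l = (if D x y = l then 1 else 0)"
proof -
  have "{z \<in> V. D x z = 0 \<and> D y z = l} = (if D x y = l then {x} else {})"
    using assms by (auto simp: D_def adj_sym)
  then show ?thesis by (simp add: K_def)
qed

lemma K_1_1:
  assumes "x \<in> V" "y \<in> V"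
  shows "K x y 1 1 = (if D x y = 0 then r else if D x y = 1 then e else d)"
proof -
  have "{z \<in> V. D x z = 1 \<and> D y z = 1} = N x \<inter> N y"
    using graphD by (auto simp: D_def mem_N)
  then show ?thesis
    using assms common_adj common_nonadj card_N by (auto simp: K_def D_def)
qed

lemma card_by_distance:
  assumes "S \<subseteq> V"
  shows "card {z \<in> S. D y z = 0} + card {z \<in> S. D y z = 1} + card {z \<in> S. D y z = 2} = card S"
proof -
  have fin: "finite S" using assms finite_V by (rule finite_subset)
  have "card S = card ({z \<in> S. D y z = 0} \<union> {z \<in> S. D y z = 1} \<union> {z \<in> S. D y z = 2})"
    by (rule arg_cong[where f = card]) (auto simp: D_def)
  also have "\<dots> = card ({z \<in> S. D y z = 0} \<union> {z \<in> S. D y z = 1}) + card {z \<in> S. D y z = 2}"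
    by (rule card_Un_disjoint) (use fin in auto)
  also have "card ({z \<in> S. D y z = 0} \<union> {z \<in> S. D y z = 1}) =
      card {z \<in> S. D y z = 0} + card {z \<in> S. D y z = 1}"
    by (rule card_Un_disjoint) (use fin in auto)
  finally show ?thesis ..
qed

lemma K_row_sum: "K x y j 0 + K x y j 1 + K x y j 2 = card {z \<in> V. D x z = j}"
  using card_by_distance[of "{z \<in> V. D x z = j}" y] by (simp add: K_def conj_assoc)

lemma card_sphere:
  assumes "x \<in> V"
  shows "card {z \<in> V. D x z = 1} = r" "1 + r + card {z \<in> V. D x z = 2} = v"
proof -
  have "{z \<in> V. D x z = 1} = N x" using graphD by (auto simp: D_def mem_N)
  then show 1: "card {z \<in> V. D x z = 1} = r" using card_N assms by simp
  have "{z \<in> V. D x z = 0} = {x}" using assms by (auto simp: D_def)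
  then show "1 + r + card {z \<in> V. D x z = 2} = v"
    using card_by_distance[of V x] 1 card_V by simp
qed

lemma K_0_right:
  assumes "y \<in> V"
  shows "K x y j 0 = (if D x y = j then 1 else 0)"
  unfolding K_sym[of x y j 0] K_0[OF assms] D_sym[of y x] ..

lemma K_1_2:
  assumes "x \<in> V" "y \<in> V"
  shows "(if D x y = 1 then 1 else 0) + K x y 1 1 + K x y 1 2 = r"
  using K_row_sum[of x y 1] unfolding card_sphere(1)[OF assms(1)] K_0_right[OF assms(2)] .

lemma K_2_2:
  assumes "x \<in> V" "y \<in> V"
  shows "1 + r + ((if D x y = 2 then 1 else 0) + K x y 1 2 + K x y 2 2) = v"
proof -
  have "(if D x y = 1 then 1 else 0) + K x y 1 1 + K x y 2 1 = r"
    using K_1_2[OF assms(2,1)] unfolding K_sym[of y x] D_sym[of y x] .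
  then have "K x y 2 1 = K x y 1 2"
    using K_1_2[OF assms] by linarith
  then show ?thesis
    using K_row_sum[of x y 2] card_sphere(2)[OF assms(1)] unfolding K_0_right[OF assms(2)] by linarith
qed

text \<open>
  All intersection numbers are determined by \<open>K x y 1 1\<close> and the row sums, hence depend only on the
  distance of \<open>x\<close> and \<open>y\<close>.
\<close>

lemma K_cong:
  assumes "x \<in> V" "y \<in> V" "x' \<in> V" "y' \<in> V" and D: "D x y = D x' y'"
  shows "K x y j l = K x' y' j l"
proof -
  have K11: "K x y 1 1 = K x' y' 1 1"
    unfolding K_1_1[OF assms(1,2)] K_1_1[OF assms(3,4)] D ..
  have K12: "K x y 1 2 = K x' y' 1 2"
    using K11 K_1_2[OF assms(1,2)] K_1_2[OF assms(3,4)] unfolding D by linarith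
  have K21: "K x y 2 1 = K x' y' 2 1"
    using K11 K_1_2[OF assms(2,1)] K_1_2[OF assms(4,3)]
    unfolding K_sym[of y x] K_sym[of y' x'] D_sym[of y x] D_sym[of y' x'] D by linarith
  have K22: "K x y 2 2 = K x' y' 2 2"
    using K12 K_2_2[OF assms(1,2)] K_2_2[OF assms(3,4)] unfolding D by linarith
  have big: "K a b j l = 0" if "j > 2 \<or> l > 2" for a b
    using that by (auto simp: K_def D_def)
  consider "j = 0" | "l = 0" | "j = 1" "l = 1" | "j = 1" "l = 2" | "j = 2" "l = 1" | "j = 2" "l = 2"
    | "j > 2 \<or> l > 2" by linarith
  then show ?thesis
  proof cases
    case 1
    then show ?thesis using D by (simp add: K_0 assms)
  next
    case 2
    then show ?thesis using D by (simp add: K_0_right assms)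
  next
    case 7
    then show ?thesis by (simp only: big)
  qed (simp_all only: K11 K12 K21 K22)
qed

lemma distance_regular: "distance_regular G"
proof -
  have eq: "card {z \<in> V. graph_dist G x z = ereal (real j) \<and> graph_dist G y z = ereal (real l)} = K x y j l"
    if "x \<in> V" "y \<in> V" for x y j l
    unfolding K_def using that by (intro arg_cong[where f = card]) (auto simp: graph_dist_eq_D)
  have "regular_graph G r" using srg by (simp add: strongly_regular_def)
  then show ?thesis
    unfolding distance_regular_def
  proof (intro conjI ballI impI allI)
    fix x y x' y' j l
    assume V: "x \<in> V" "y \<in> V" "x' \<in> V" "y' \<in> V" and "graph_dist G x y = graph_dist G x' y'"
    then have "D x y = D x' y'" by (simp add: graph_dist_eq_D)
    then show "card {z \<in> V. graph_dist G x z = ereal (real j) \<and> graph_dist G y z = ereal (real l)} =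
        card {z \<in> V. graph_dist G x' z = ereal (real j) \<and> graph_dist G y' z = ereal (real l)}"
      unfolding eq[OF V(1,2)] eq[OF V(3,4)] by (rule K_cong[OF V])
  qed blast
qed

lemma has_intersection_array:
  "has_intersection_array G (int r) (int r - int e - 1) 1 (int d)"
proof -
  have num: "(0 :: ereal) = ereal (real 0)" "(1 :: ereal) = ereal (real 1)"
    "(2 :: ereal) = ereal (real 2)" by auto
  have eq: "card {z \<in> N y. graph_dist G x z = ereal (real j)} = K x y j 1"
    if "x \<in> V" "y \<in> V" for x y j
  proof -
    have "{z \<in> N y. graph_dist G x z = ereal (real j)} = {z \<in> V. D x z = j \<and> D y z = 1}"
      using that N_subset[of y] graphD(4) by (auto simp: graph_dist_eq_D mem_N D_def split: if_splits)
    then show ?thesis by (simp add: K_def)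
  qed
  show ?thesis
    unfolding has_intersection_array_def num
  proof (intro ballI)
    fix x y assume xy: "x \<in> V" "y \<in> V"
    have K21: "K x y 2 1 = K y x 1 2" by (rule K_sym)
    show "(graph_dist G x y = ereal (real 0) \<longrightarrow>
          int (card {z \<in> N y. graph_dist G x z = ereal (real 1)}) = int r) \<and>
        (graph_dist G x y = ereal (real 1) \<longrightarrow>
          int (card {z \<in> N y. graph_dist G x z = ereal (real 2)}) = int r - int e - 1 \<and>
          int (card {z \<in> N y. graph_dist G x z = ereal (real 0)}) = 1) \<and>
        (graph_dist G x y = ereal (real 2) \<longrightarrow>
          int (card {z \<in> N y. graph_dist G x z = ereal (real 1)}) = int d)"
      unfolding eq[OF xy] unfolding graph_dist_eq_D[OF xy]
      using K_0[OF xy(1), of y 1] K_1_1[OF xy] K_1_1[OF xy(2,1)] K_1_2[OF xy(2,1)] K21 D_sym[of x y]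
      by auto
  qed
qed

lemma complement_strongly_regular:
  obtains e' d' where "int e' = int v - 2 - 2 * int r + int d" "int d' = int v - 2 * int r + int e"
    "strongly_regular (graph_complement G) v (v - 1 - r) e' d'"
proof -
  let ?C = "graph_complement G"
  have pgC: "pair_graph ?C"
    by (rule pair_graphI) (auto simp: graph_complement_def finite_V adj_sym)
  have NC: "neighbours ?C x = {z \<in> V. D x z = 2}" if "x \<in> V" for x
    using that by (auto simp: neighbours_def graph_complement_def D_def)
  have arcC: "(x, y) \<in> parcs ?C \<longleftrightarrow> x \<in> V \<and> y \<in> V \<and> D x y = 2" for x y
    by (auto simp: graph_complement_def D_def)
  have NNC: "card (neighbours ?C x \<inter> neighbours ?C y) = K x y 2 2" if "x \<in> V" "y \<in> V" for x y
    unfolding NC[OF that(1)] NC[OF that(2)] K_def by (rule arg_cong[where f = card]) auto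
  have VC: "pverts ?C = V" by (simp add: graph_complement_def)
  obtain a b where ab: "a \<in> V" "b \<in> V" "a \<noteq> b" "(a, b) \<notin> parcs G" by (rule nonadjacent_pair)
  obtain a' b' where ab': "a' \<in> V" "b' \<in> V" "a' \<noteq> b'" "(a', b') \<in> parcs G" by (rule adjacent_pair)
  have Dab: "D a b = 2" "D a' b' = 1" using ab ab' by (auto simp: D_def)
  have e': "int (K x y 2 2) = int v - 2 - 2 * int r + int d" if "x \<in> V" "y \<in> V" "D x y = 2" for x y
    using K_2_2[OF that(1,2)] K_1_2[OF that(1,2)] K_1_1[OF that(1,2)] that(3) by simp
  have d': "int (K x y 2 2) = int v - 2 * int r + int e" if "x \<in> V" "y \<in> V" "D x y = 1" for x y
    using K_2_2[OF that(1,2)] K_1_2[OF that(1,2)] K_1_1[OF that(1,2)] that(3) by simp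
  have "parcs ?C \<noteq> {}" using ab arcC[of a b] Dab by auto
  moreover have "\<not> complete_digraph (card (pverts ?C)) (with_proj ?C)"
    using ab' arcC[of a' b'] Dab by (auto simp: complete_digraph_def VC)
  moreover have "regular_graph ?C (v - 1 - r)"
  proof -
    have "card {z \<in> V. D x z = 2} = v - 1 - r" if "x \<in> V" for x
      using card_sphere(2)[OF that] by linarith
    then show ?thesis unfolding regular_graph_def using pgC by (simp add: VC NC)
  qed
  moreover have "card (neighbours ?C x \<inter> neighbours ?C y) = K a b 2 2"
    if "x \<in> V" "y \<in> V" "(x, y) \<in> parcs ?C" for x y
    unfolding NNC[OF that(1,2)] using that ab(1,2) Dab by (intro K_cong) (simp_all add: arcC)
  moreover have "card (neighbours ?C x \<inter> neighbours ?C y) = K a' b' 2 2"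
    if "x \<in> V" "y \<in> V" "x \<noteq> y" "(x, y) \<notin> parcs ?C" for x y
  proof -
    have "D x y = 1" using that by (auto simp: arcC D_def split: if_splits)
    then show ?thesis
      unfolding NNC[OF that(1,2)] using that(1,2) ab'(1,2) Dab by (intro K_cong) simp_all
  qed
  ultimately have "strongly_regular ?C v (v - 1 - r) (K a b 2 2) (K a' b' 2 2)"
    unfolding strongly_regular_def VC using card_V by blast
  then show ?thesis
    using that e'[OF ab(1,2) Dab(1)] d'[OF ab'(1,2) Dab(2)] by blast
qed

lemma not_bipartite: "\<not> bipartite_graph G"
proof
  assume "bipartite_graph G"
  then obtain X Y where XY: "X \<union> Y = V" "X \<inter> Y = {}" "parcs G \<subseteq> X \<times> Y \<union> Y \<times> X"
    unfolding bipartite_graph_def by blast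
  \<comment> \<open>Vertices on opposite sides have no common neighbour, so they are adjacent.\<close>
  have opp: "(x, y) \<in> parcs G" if "x \<in> X \<and> y \<in> Y \<or> x \<in> Y \<and> y \<in> X" for x y
  proof (rule ccontr)
    assume na: "(x, y) \<notin> parcs G"
    have "x \<in> V" "y \<in> V" "x \<noteq> y" using that XY(1,2) by auto
    then obtain z where "(x, z) \<in> parcs G" "(z, y) \<in> parcs G" using na by (rule common_neighbour)
    then show False using that XY by blast
  qed
  obtain a b where ab: "a \<in> V" "b \<in> V" "a \<noteq> b" "(a, b) \<notin> parcs G" by (rule nonadjacent_pair)
  then have "a \<in> X \<and> b \<in> X \<or> a \<in> Y \<and> b \<in> Y" using opp XY(1) by blast
  then have "N a = N b" using opp XY by (auto simp: mem_N)
  then show False using common_nonadj[OF ab] card_N[OF ab(1)] d_less by simp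
qed

text \<open>The entries of the adjacency matrix, which satisfies \<open>A\<^sup>2 = (e - d) A + (r - d) I + d J\<close>.\<close>

definition A :: "'a \<Rightarrow> 'a \<Rightarrow> complex" where
  "A x y = (if (x, y) \<in> parcs G then 1 else 0)"

lemma sum_N: "(\<Sum>z\<in>N x. F z) = (\<Sum>z\<in>V. A x z * F z)"
  by (rule sum.mono_neutral_cong_left) (use finite_V N_subset in \<open>auto simp: A_def mem_N\<close>)

lemma adjacency_square:
  assumes "x \<in> V" "y \<in> V"
  shows "(\<Sum>z\<in>N x. A z y) = (of_nat e - of_nat d) * A x y
    + (of_nat r - of_nat d) * (if x = y then 1 else 0) + of_nat d"
proof -
  have "(\<Sum>z\<in>N x. A z y) = (\<Sum>z\<in>N x \<inter> N y. 1)"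
    by (rule sum.mono_neutral_cong_right) (use finite_N adj_sym in \<open>auto simp: A_def mem_N\<close>)
  also have "\<dots> = of_nat (card (N x \<inter> N y))" by simp
  finally show ?thesis
    using assms common_adj[of x y] common_nonadj[of x y] card_N[of x] graphD(4)[of x]
    by (auto simp: A_def)
qed

text \<open>
  The hypotheses say that \<open>f\<close> and \<open>g\<close> are the roots of \<open>X\<^sup>2 - (e - d) X - (r - d)\<close>, the
  polynomial that the adjacency matrix satisfies on vectors with coordinate sum zero. Both roots
  occur as eigenvalues because the graph is neither complete nor empty.
\<close>

lemma adjacency_eigenvalues_eq:
  fixes f g :: real
  assumes sum: "f + g = real e - real d" and prod: "f * g = real d - real r"
  shows "adjacency_eigenvalues G = complex_of_real ` {real r, f, g}"
proof (intro subset_antisym subsetI)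
  have sum': "of_nat e - of_nat d = complex_of_real (f + g)"
    and prod': "of_nat r - of_nat d = - complex_of_real (f * g)"
    unfolding sum prod by simp_all
  fix c assume "c \<in> adjacency_eigenvalues G"
  then obtain h u where u: "u \<in> V" "h u \<noteq> 0"
    and h: "\<And>x. x \<in> V \<Longrightarrow> (\<Sum>z\<in>N x. h z) = c * h x"
    unfolding adjacency_eigenvalues_def by blast
  let ?S = "\<Sum>z\<in>V. h z"
  have "c * ?S = (\<Sum>x\<in>V. \<Sum>z\<in>V. A x z * h z)"
    by (simp add: sum_distrib_left h flip: sum_N)
  also have "\<dots> = (\<Sum>z\<in>V. (\<Sum>x\<in>V. A z x * 1) * h z)"
    by (subst sum.swap) (simp add: sum_distrib_right A_def adj_sym)
  also have "\<dots> = (\<Sum>z\<in>V. of_nat r * h z)"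
  proof (rule sum.cong)
    fix z assume z: "z \<in> V"
    have "(\<Sum>x\<in>V. A z x * 1) = (\<Sum>x\<in>N z. 1)" by (rule sum_N[symmetric])
    then show "(\<Sum>x\<in>V. A z x * 1) * h z = of_nat r * h z" using card_N[OF z] by simp
  qed simp
  also have "\<dots> = of_nat r * ?S" by (simp add: sum_distrib_left)
  finally have cS: "c * ?S = of_nat r * ?S" .
  show "c \<in> complex_of_real ` {real r, f, g}"
  proof (cases "?S = 0")
    case False
    then show ?thesis using cS by simp
  next
    case True
    have "c * c * h u = (\<Sum>z\<in>N u. \<Sum>y\<in>N z. h y)"
    proof -
      have "(\<Sum>z\<in>N u. \<Sum>y\<in>N z. h y) = (\<Sum>z\<in>N u. c * h z)"
        using h N_subset by (intro sum.cong) auto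
      also have "\<dots> = c * (c * h u)" unfolding sum_distrib_left[symmetric] h[OF u(1)] ..
      finally show ?thesis by simp
    qed
    also have "\<dots> = (\<Sum>y\<in>V. (\<Sum>z\<in>N u. A z y) * h y)"
      unfolding sum_N[where F = h] by (subst sum.swap) (simp add: sum_distrib_right)
    also have "\<dots> = (\<Sum>y\<in>V. (of_nat e - of_nat d) * (A u y * h y)
        + (of_nat r - of_nat d) * (if u = y then h y else 0) + of_nat d * h y)"
    proof (rule sum.cong)
      fix y assume "y \<in> V"
      show "(\<Sum>z\<in>N u. A z y) * h y = (of_nat e - of_nat d) * (A u y * h y)
          + (of_nat r - of_nat d) * (if u = y then h y else 0) + of_nat d * h y"
        unfolding adjacency_square[OF u(1) \<open>y \<in> V\<close>] by (simp add: distrib_right)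
    qed simp
    also have "\<dots> = (of_nat e - of_nat d) * (\<Sum>y\<in>V. A u y * h y)
        + (of_nat r - of_nat d) * (\<Sum>y\<in>V. if u = y then h y else 0) + of_nat d * ?S"
      by (simp only: sum.distrib sum_distrib_left)
    also have "\<dots> = (of_nat e - of_nat d) * (c * h u) + (of_nat r - of_nat d) * h u"
      unfolding sum_N[symmetric, of u h] h[OF u(1)] True using u(1) finite_V by simp
    finally have "((c - f) * (c - g)) * h u = 0"
      unfolding sum' prod' of_real_add of_real_mult by (simp add: algebra_simps)
    then have "c = f \<or> c = g" using u(2) by simp
    then show ?thesis by blast
  qed
next
  have sum': "of_nat e - of_nat d = complex_of_real (f + g)"
    and prod': "of_nat r - of_nat d = - complex_of_real (f * g)"
    unfolding sum prod by simp_all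
  \<comment> \<open>For vertices \<open>a\<close>, \<open>b\<close> the vector \<open>(A - g I)(\<delta>\<^sub>a - \<delta>\<^sub>b)\<close> is killed by \<open>A - f I\<close>.\<close>
  have eigen: "complex_of_real f' \<in> adjacency_eigenvalues G"
    if fg: "of_nat e - of_nat d = complex_of_real (f' + g')"
      "of_nat r - of_nat d = - complex_of_real (f' * g')" for f' g' :: real
  proof -
    obtain a b where ab: "a \<in> V" "b \<in> V" "a \<noteq> b" "A a b \<noteq> - g'"
    proof (cases "- complex_of_real g' = 0")
      case True
      obtain a b where "a \<in> V" "b \<in> V" "a \<noteq> b" "(a, b) \<in> parcs G" by (rule adjacent_pair)
      then show ?thesis using that[of a b] True by (simp add: A_def)
    next
      case False
      obtain a b where "a \<in> V" "b \<in> V" "a \<noteq> b" "(a, b) \<notin> parcs G" by (rule nonadjacent_pair)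
      then show ?thesis using that[of a b] False by (simp add: A_def)
    qed
    let ?\<delta> = "\<lambda>x y :: 'a. if x = y then 1 else 0 :: complex"
    let ?h = "\<lambda>x. A x a - A x b - g' * (?\<delta> x a - ?\<delta> x b)"
    have nz: "?h a \<noteq> 0"
    proof -
      have "A a a = 0" using graphD(4) by (simp add: A_def)
      then have h: "?h a = - (A a b + g')" using ab(3) by simp
      have "A a b + g' \<noteq> 0" using ab(4) by (simp add: eq_neg_iff_add_eq_0)
      then show ?thesis unfolding h by (simp only: neg_equal_0_iff_equal not_False_eq_True)
    qed
    have alg: "(F + F') * u + - (F * F') * v + c - ((F + F') * u' + - (F * F') * v' + c) - F' * (u - u') =
        F * (u - u' - F' * (v - v'))" for F F' u v u' v' c :: complex
      by (simp add: algebra_simps)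
    have "(\<Sum>z\<in>N x. ?h z) = f' * ?h x" if x: "x \<in> V" for x
    proof -
      have dl: "(\<Sum>z\<in>N x. ?\<delta> z y) = A x y" for y
        using finite_N by (simp add: A_def mem_N)
      have "(\<Sum>z\<in>N x. ?h z) = (\<Sum>z\<in>N x. A z a) - (\<Sum>z\<in>N x. A z b)
          - g' * ((\<Sum>z\<in>N x. ?\<delta> z a) - (\<Sum>z\<in>N x. ?\<delta> z b))"
        unfolding sum_subtractf[symmetric] sum_distrib_left ..
      also have "\<dots> = f' * ?h x"
        unfolding dl adjacency_square[OF x ab(1)] adjacency_square[OF x ab(2)] fg of_real_add of_real_mult
        by (rule alg)
      finally show ?thesis .
    qed
    then show ?thesis
      unfolding adjacency_eigenvalues_def using ab(1) nz by (intro CollectI exI[of _ ?h] conjI bexI[of _ a] ballI)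
  qed
  fix c assume "c \<in> complex_of_real ` {real r, f, g}"
  then consider "c = of_nat r" | "c = f" | "c = g" by auto
  then show "c \<in> adjacency_eigenvalues G"
  proof cases
    case 1
    obtain x y where "x \<in> V" "y \<in> V" "x \<noteq> y" "(x, y) \<in> parcs G" by (rule adjacent_pair)
    then have "\<exists>u\<in>V. (\<lambda>_. 1 :: complex) u \<noteq> 0" by auto
    moreover have "\<forall>u\<in>V. (\<Sum>z\<in>N u. (\<lambda>_. 1) z) = c * (\<lambda>_. 1 :: complex) u"
      using card_N by (simp add: 1)
    ultimately show ?thesis
      unfolding adjacency_eigenvalues_def by (intro CollectI exI[of _ "\<lambda>_. 1"] conjI)
  next
    case 2
    then show ?thesis using eigen[OF sum' prod'] by (simp only:)
  next
    case 3
    have "complex_of_real g \<in> adjacency_eigenvalues G"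
      using sum' prod' unfolding add.commute[of f g] mult.commute[of f g] by (rule eigen)
    then show ?thesis using 3 by (simp only:)
  qed
qed

lemma nontrivial_eigenvalues_eq:
  fixes f g :: real
  assumes "f + g = real e - real d" "f * g = real d - real r" "f \<noteq> real r" "g \<noteq> real r"
  shows "nontrivial_eigenvalues G = complex_of_real ` {f, g}"
proof -
  have "r' = r" if "regular_graph G r'" for r'
  proof -
    obtain x y where x: "x \<in> V" "y \<in> V" "x \<noteq> y" "(x, y) \<in> parcs G" by (rule adjacent_pair)
    have "card (N x) = r'" using that x(1) by (simp add: regular_graph_def)
    then show ?thesis using card_N[OF x(1)] by simp
  qed
  moreover have "regular_graph G r" using srg by (simp add: strongly_regular_def)
  ultimately have "regular_graph G r' \<longleftrightarrow> r' = r" for r' by blast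
  then have eq: "nontrivial_eigenvalues G = {c \<in> adjacency_eigenvalues G. c \<noteq> of_nat r}"
    unfolding nontrivial_eigenvalues_def by auto
  have "complex_of_real f \<noteq> of_nat r" "complex_of_real g \<noteq> of_nat r"
    using assms(3,4) by (metis of_real_of_nat_eq of_real_eq_iff)+
  then show ?thesis
    unfolding eq adjacency_eigenvalues_eq[OF assms(1,2)] by auto
qed

end

section \<open>The generalized Paley graphs of semiprimitive pairs\<close>

text \<open>
  The bound \<open>g \<le> - 2\<close> ensures \<open>f < r\<close>; for \<open>g = - 1\<close> the equation for \<open>r\<close> would give \<open>r = f\<close>.
\<close>

lemma (in primitive_srg) latin_square_parameters:
  fixes f g :: real
  assumes fg: "f > 0" "g \<le> - 2" and sum: "f + g = real e - real d" and prod: "f * g = real d - real r"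
    and v: "real v = (f - g)\<^sup>2" and r: "real r = - g * (f - g - 1)"
  shows "pseudo_Latin_square_graph G \<and>
    (\<exists>f g :: real. f > 0 \<and> 0 > g \<and> nontrivial_eigenvalues G = complex_of_real ` {f, g} \<and>
      has_PL_parameters G (- g) (f - g))"
proof -
  have "real r - f = (- g - 1) * (f - g)" unfolding r by (simp add: algebra_simps)
  moreover have "(- g - 1) * (f - g) > 0" using fg by (intro mult_pos_pos) auto
  ultimately have rf: "real r > f" by linarith
  have d: "real d = - g * (- g - 1)" using prod r by (simp add: algebra_simps)
  have e: "real e = (- g)\<^sup>2 - 3 * (- g) + (f - g)"
    using sum d by (simp add: algebra_simps power2_eq_square)
  have "pseudo_Latin_square_graph G"
    unfolding pseudo_Latin_square_graph_def
  proof (rule exI[of _ v], rule exI[of _ r], rule exI[of _ e], rule exI[of _ d],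
      rule exI[of _ f], rule exI[of _ g], intro conjI)
    show "0 > g" using fg(2) by simp
  qed (fact srg adjacency_eigenvalues_eq[OF sum prod] rf fg(1) r)+
  moreover have "nontrivial_eigenvalues G = complex_of_real ` {f, g}"
    using rf fg by (intro nontrivial_eigenvalues_eq[OF sum prod]) auto
  moreover have "has_PL_parameters G (- g) (f - g)"
    unfolding has_PL_parameters_def
    by (rule exI[of _ v], rule exI[of _ r], rule exI[of _ e], rule exI[of _ d], intro conjI)
      (fact srg v r e d)+
  moreover have "0 > g" using fg(2) by simp
  ultimately show ?thesis using fg(1) by blast
qed

lemma (in primitive_srg) integral:
  fixes f g :: int
  assumes "of_int f + of_int g = real e - real d" "of_int f * of_int g = real d - real r"
  shows "integral_graph G"
  unfolding integral_graph_def adjacency_eigenvalues_eq[OF assms] by auto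

text \<open>
  The generalized Paley graph is a Cayley graph on the additive group, so common neighbours of \<open>x\<close>
  and \<open>y\<close> correspond to representations of \<open>y - x\<close> as a difference of two \<open>k\<close>-th powers.
\<close>

lemma generalized_Paley_strongly_regular:
  fixes k e d :: nat
  defines "H \<equiv> kth_powers k :: 'a::{field,finite} set"
  assumes minus: "- 1 \<in> H"
    and count: "\<And>a. a \<noteq> 0 \<Longrightarrow>
      card {(x, y). x \<in> H \<and> y \<in> H \<and> x - y = a} = (if a \<in> H then e else d)"
    and not_all: "card H < card (UNIV :: 'a set) - 1"
  shows "strongly_regular (generalized_Paley_graph k :: 'a pair_pre_digraph) (card (UNIV :: 'a set)) (card H) e d"
proof -
  let ?G = "generalized_Paley_graph k :: 'a pair_pre_digraph"
  have arcs: "(u, v) \<in> parcs ?G \<longleftrightarrow> v - u \<in> H" for u v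
    by (simp add: generalized_Paley_graph_def H_def kth_powers_def)
  have V: "pverts ?G = UNIV" by (simp add: generalized_Paley_graph_def)
  have sym: "u - v \<in> H" if "v - u \<in> H" for u v
    using kth_powers_mult[OF minus[unfolded H_def] that[unfolded H_def]] by (simp add: H_def)
  have nz: "(0 :: 'a) \<notin> H" using kth_powers_nonzero[of 0 k] by (auto simp: H_def)
  have pg: "pair_graph ?G"
    by (rule pair_graphI) (auto simp: arcs V nz intro: sym)
  have N: "neighbours ?G u = {v. v - u \<in> H}" for u by (simp add: neighbours_def arcs)
  have deg: "card (neighbours ?G u) = card H" for u
    unfolding N by (rule bij_betw_same_card[of "\<lambda>v. v - u"], rule bij_betwI[of _ _ _ "\<lambda>h. h + u"]) auto
  have common: "card (neighbours ?G x \<inter> neighbours ?G y) =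
      card {(h, h'). h \<in> H \<and> h' \<in> H \<and> h - h' = y - x}" for x y
  proof (rule bij_betw_same_card[of "\<lambda>z. (z - x, z - y)"], rule bij_betwI[of _ _ _ "\<lambda>(h, h'). h + x"])
    have eq: "h + x - y = h'" if "h - h' = y - x" for h h'
      using that by (simp add: algebra_simps)
    show "(\<lambda>(h, h'). h + x) \<in> {(h, h'). h \<in> H \<and> h' \<in> H \<and> h - h' = y - x} \<rightarrow>
        neighbours ?G x \<inter> neighbours ?G y"
      using eq by (auto simp: N)
    show "((case z of (h, h') \<Rightarrow> h + x) - x, (case z of (h, h') \<Rightarrow> h + x) - y) = z"
      if "z \<in> {(h, h'). h \<in> H \<and> h' \<in> H \<and> h - h' = y - x}" for z
      using that eq by auto
  qed (auto simp: N)
  have "H \<noteq> UNIV - {0}" using not_all by auto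
  moreover have "H \<subseteq> UNIV - {0}" using nz by auto
  ultimately obtain a where a: "a \<noteq> 0" "a \<notin> H" by auto
  have "(0, 1) \<in> parcs ?G" using kth_powers_one by (simp add: arcs H_def)
  moreover have "\<not> complete_digraph (card (pverts ?G)) (with_proj ?G)"
  proof
    assume "complete_digraph (card (pverts ?G)) (with_proj ?G)"
    then have "(0, a) \<in> parcs ?G" using a(1) by (auto simp: complete_digraph_def V)
    then show False using a(2) by (simp add: arcs)
  qed
  moreover have "regular_graph ?G (card H)" using pg deg by (simp add: regular_graph_def)
  moreover have "card (neighbours ?G x \<inter> neighbours ?G y) = e" if "(x, y) \<in> parcs ?G" for x y
  proof -
    have "y - x \<in> H" using that unfolding arcs .
    then show ?thesis using count[of "y - x"] nz unfolding common by (metis (full_types))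
  qed
  moreover have "card (neighbours ?G x \<inter> neighbours ?G y) = d" if "x \<noteq> y" "(x, y) \<notin> parcs ?G" for x y
  proof -
    have "y - x \<notin> H" "y - x \<noteq> 0" using that unfolding arcs by simp_all
    then show ?thesis using count[of "y - x"] unfolding common by (metis (full_types))
  qed
  ultimately show ?thesis
    unfolding strongly_regular_def V by blast
qed

theorem theorem5p8:
  fixes p m q k t s n :: nat
    and \<sigma> lambda2 :: real
    and \<Gamma> \<Gamma>c :: "'a::{field,finite} pair_pre_digraph"
  assumes "prime p"
    and "q = p ^ m"
    and "card (UNIV :: 'a set) = q"
    and "k dvd q - 1"
    and "semiprimitive_pair k p m"
    and "m = 2 * t * s"
    and "t > 0" "k dvd p ^ t + 1" "\<forall>u > 0. k dvd p ^ u + 1 \<longrightarrow> t \<le> u"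
    and "n = (q - 1) div k"
    and "\<sigma> = (-1) ^ (s + 1)"
    and "lambda2 = - (\<sigma> * real p ^ (m div 2) + 1) / real k"
    and "\<Gamma> = generalized_Paley_graph k"
    and "\<Gamma>c = graph_complement \<Gamma>"
  shows "\<exists>e d e' d' :: nat.
     real d = real n + (\<sigma> * real p ^ (m div 2) + lambda2) * lambda2 \<and>
     real e = real d + (\<sigma> * real p ^ (m div 2) + 2 * lambda2) \<and>
     real e' = real q - 2 - 2 * real n + real d \<and>
     real d' = real q - 2 * real n + real e \<and>
     \<comment> \<open>(a)\<close>
     (strongly_regular \<Gamma> q n e d \<and> primitive_graph \<Gamma> \<and>
      \<not> bipartite_graph \<Gamma> \<and> integral_graph \<Gamma> \<and>
      strongly_regular \<Gamma>c q ((k - 1) * n) e' d' \<and> primitive_graph \<Gamma>c \<and>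
      \<not> bipartite_graph \<Gamma>c \<and> integral_graph \<Gamma>c) \<and>
     \<comment> \<open>(b)\<close>
     (distance_regular \<Gamma> \<and> graph_diameter \<Gamma> = 2 \<and>
      has_intersection_array \<Gamma> (int n) (int n - int e - 1) 1 (int d) \<and>
      distance_regular \<Gamma>c \<and> graph_diameter \<Gamma>c = 2 \<and>
      has_intersection_array \<Gamma>c ((int k - 1) * int n) (int n - int d) 1
        (int q - 2 * int n + int e)) \<and>
     \<comment> \<open>(c)\<close>
     (odd s \<longrightarrow>
        (\<forall>H \<in> {\<Gamma>, \<Gamma>c}.
           pseudo_Latin_square_graph H \<and>
           (\<exists>f g :: real. f > 0 \<and> 0 > g \<and>
              nontrivial_eigenvalues H = complex_of_real ` {f, g} \<and>
              has_PL_parameters H (- g) (f - g))))"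
proof -
  note q = assms(2) and card = assms(3) and semi = assms(5) and m = assms(6)
  obtain \<psi> :: "'a \<Rightarrow> complex" where "frobenius_character p m \<psi>"
    using exists_frobenius_character[OF assms(1), of m, where 'a='a] card q by auto
  then interpret semiprimitive_field p m \<psi> t s
    using m \<open>t > 0\<close> by (intro semiprimitive_field.intro semiprimitive_field_axioms.intro)
  define w where "w = P ^ s"
  define H where "H = (kth_powers k :: 'a set)"
  have s0: "s > 0"
    using card card_field_gt_1[where 'a='a] unfolding q m by (auto intro: Nat.gr0I)
  have w_p: "p ^ (m div 2) = w" by (simp add: m w_def P_def power_mult)
  have qw: "q = w * w" unfolding q q_eq w_def ..
  have kP: "k dvd P + 1" using assms(8) by (simp add: P_def)
  have k2: "k \<ge> 2" using semi by (auto simp: semiprimitive_pair_def)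
  have Pw: "P \<le> w" using P_ge_2 s0 self_le_power[of P s] by (simp add: w_def)
  then have w2: "w \<ge> 2" using P_ge_2 by linarith
  have nk: "n * k = q - 1" using assms(4,10) by simp
  have card_Hn: "card H = n"
    using card_kth_powers[of k, where 'a='a] assms(4,10) by (simp add: H_def card)
  have minus: "- 1 \<in> H" using minus_one_in_H H_subset[OF kP] by (auto simp: H_def)
  \<comment> \<open>The nontrivial eigenvalues \<open>L\<close> and \<open>f\<close> of \<open>\<Gamma>\<close> are integers, by \<open>p\<^sup>t \<equiv> - 1\<close> modulo \<open>k\<close>.\<close>
  define W :: int where "W = (- 1) ^ (s + 1) * int w"
  have WW: "W * W = int q" by (simp add: W_def qw power_add flip: power_mult_distrib)
  have "int k dvd W + 1"
  proof -
    have "int k dvd int (P + 1)" using kP by (simp only: int_dvd_int_iff)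
    then have "[int P = - 1] (mod int k)" by (simp add: cong_iff_dvd_diff add.commute)
    then have "[(- 1) ^ (s + 1) * int P ^ s + 1 = (- 1) ^ (s + 1) * (- 1) ^ s + 1] (mod int k)"
      by (intro cong_add cong_mult cong_pow cong_refl)
    moreover have "(- 1) ^ (s + 1) * (- 1) ^ s + 1 = (0 :: int)" by (simp flip: power_add)
    ultimately show ?thesis by (simp add: W_def w_def cong_0_iff)
  qed
  then obtain L' where L': "W + 1 = int k * L'" by (elim dvdE)
  define L where "L = - L'"
  define f where "f = L + W"
  have L: "int k * L = - (W + 1)" using L' by (simp add: L_def)
  have n_int: "int n = - L * (W - 1)"
  proof -
    have "int k * int n = int q - 1"
      using nk card_field_gt_1[where 'a='a] card by (simp add: mult.commute of_nat_diff flip: of_nat_mult)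
    also have "\<dots> = (W + 1) * (W - 1)" unfolding WW[symmetric] by (simp add: algebra_simps)
    also have "\<dots> = - (int k * L) * (W - 1)" unfolding L by (simp add: algebra_simps)
    also have "\<dots> = int k * (- L * (W - 1))" by simp
    finally show ?thesis using k2 unfolding mult_cancel_left by simp
  qed
  have sigma_W: "\<sigma> * real p ^ (m div 2) = of_int W"
    by (simp add: assms(11) W_def flip: w_p)
  have lam: "lambda2 = of_int L"
  proof -
    have "real k * of_int L = of_int (int k * L)" by simp
    also have "\<dots> = - (of_int W + 1)" unfolding L by simp
    finally show ?thesis unfolding assms(12) sigma_W using k2 by (simp add: field_simps)
  qed
  have signs: "odd s \<and> L \<le> - 2 \<and> 1 \<le> f \<or> even s \<and> 1 \<le> L \<and> f \<le> - 2"
  proof (cases "odd s")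
    case True
    then have W: "W = int w" by (simp add: W_def)
    have kL: "int k * (- L) = int w + 1" using L W by simp
    then have "int k * (- L) > 0" by simp
    then have L0: "- L > 0" using k2 by (simp add: zero_less_mult_iff mult_less_0_iff)
    have L1: "- L \<noteq> 1"
    proof
      assume "- L = 1"
      then have "k = w + 1" using kL by simp
      then have "k = p ^ (m div 2) + 1" by (simp add: w_p)
      then show False using semi w2 \<open>k = w + 1\<close> by (auto simp: semiprimitive_pair_def)
    qed
    have "2 * (- L) \<le> int w + 1"
      unfolding kL[symmetric] using k2 L0 by (intro mult_right_mono) auto
    then have "1 \<le> f" using w2 unfolding f_def W by linarith
    moreover have "L \<le> - 2" using L0 L1 by linarith
    ultimately show ?thesis using True by blast
  next
    case False
    then have W: "W = - int w" by (simp add: W_def)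
    have kL: "int k * L = int w - 1" using L W by simp
    then have "int k * L > 0" using w2 by simp
    then have L0: "L > 0" using k2 by (simp add: zero_less_mult_iff)
    have "2 * L \<le> int w - 1"
      unfolding kL[symmetric] using k2 L0 by (intro mult_right_mono) auto
    then have "f \<le> - 2" using w2 unfolding f_def W by linarith
    moreover have "1 \<le> L" using L0 by linarith
    ultimately show ?thesis using False by blast
  qed
  have pos: "L * (L + 1) > 0" "f * (f + 1) > 0" "- (L * f) > 0" "- ((1 + L) * (1 + f)) > 0"
    using signs by (auto simp: zero_less_mult_iff mult_less_0_iff)
  \<comment> \<open>The strongly regular parameters of the graph.\<close>
  obtain g where g: "g \<noteq> 0"
    and period: "\<And>k b. k dvd P + 1 \<Longrightarrow> b \<noteq> 0 \<Longrightarrow> (\<Sum>h\<in>kth_powers k. \<psi> (b * h)) =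
       - ((- 1) ^ (s + 1) * of_nat (P ^ s) + 1) / of_nat k +
       (if b * g \<in> kth_powers k then (- 1) ^ (s + 1) * of_nat (P ^ s) else 0)"
    by (rule period_values) (rule that; (assumption | simp only:))
  have Wc: "(- 1) ^ (s + 1) * of_nat (P ^ s) = (of_int W :: complex)"
    by (simp add: W_def w_def)
  have Lc: "of_nat k * of_int L = - (of_int W + 1 :: complex)"
  proof -
    have "of_nat k * of_int L = (of_int (int k * L) :: complex)" by simp
    then show ?thesis unfolding L by simp
  qed
  have Lc': "- (of_int W + 1) / of_nat k = (of_int L :: complex)"
    unfolding Lc[symmetric] using k2 by simp
  have count: "int (card {(x, y). x \<in> H \<and> y \<in> H \<and> x - y = a}) =
      L * (L + 1) + (if a \<in> H then 2 * L + W else 0)" if "a \<noteq> 0" for a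
  proof -
    have "of_nat (card {(x, y). x \<in> H \<and> y \<in> H \<and> x - y = a}) =
        of_int L * (of_int L + 1) + (if a \<in> H then 2 * of_int L + of_int W else (0 :: complex))"
      unfolding H_def
    proof (rule difference_count[OF _ _ g _ Lc _ that])
      show "k dvd p ^ m - 1" using assms(4) q by simp
      show "- 1 \<in> (kth_powers k :: 'a set)" using minus by (simp add: H_def)
      show "of_int W * of_int W = (of_nat (p ^ m) :: complex)"
        unfolding q[symmetric] of_int_mult[symmetric] WW by simp
      show "(\<Sum>h\<in>kth_powers k. \<psi> (b * h)) = of_int L + (if b * g \<in> kth_powers k then of_int W else 0)"
        if "b \<noteq> 0" for b
        using period[OF kP that] unfolding Wc Lc' .
    qed
    also have "\<dots> = of_int (L * (L + 1) + (if a \<in> H then 2 * L + W else 0))" by simp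
    finally show ?thesis
      unfolding of_int_of_nat_eq[symmetric, where 'a = complex] of_int_eq_iff .
  qed
  define d where "d = nat (L * (L + 1))"
  define e where "e = card {(x, y). x \<in> H \<and> y \<in> H \<and> x - y = 1}"
  have d_int: "int d = L * (L + 1)" using pos(1) by (simp add: d_def)
  have "1 \<in> H" by (simp add: H_def kth_powers_one)
  then have e_int: "int e = L * (L + 1) + (2 * L + W)"
    using count[of 1] by (simp add: e_def)
  have n_less: "n < q - 1"
  proof -
    have "n > 0" using nk card_field_gt_1[where 'a='a] card by (auto intro: Nat.gr0I)
    then have "n * 1 < n * k" using k2 by (intro mult_strict_left_mono) auto
    then show ?thesis using nk by simp
  qed
  have srg: "strongly_regular \<Gamma> q n e d"
    unfolding assms(13) card[symmetric] card_Hn[symmetric] H_def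
  proof (rule generalized_Paley_strongly_regular)
    show "card {(x, y). x \<in> kth_powers k \<and> y \<in> kth_powers k \<and> x - y = a} =
        (if a \<in> kth_powers k then e else d)" if "a \<noteq> 0" for a :: 'a
      using count[OF that] e_int d_int unfolding H_def by (auto split: if_splits)
  qed (use minus n_less card card_Hn in \<open>simp_all add: H_def\<close>)
  have nd: "int n - int d = - (L * f)"
    unfolding n_int d_int f_def by (simp add: algebra_simps)
  interpret G: primitive_srg \<Gamma> q n e d
    using srg pos(1,3) nd d_int by unfold_locales linarith+
  obtain e' d' where e': "int e' = int q - 2 - 2 * int n + int d"
    and d': "int d' = int q - 2 * int n + int e" and srg': "strongly_regular \<Gamma>c q (q - 1 - n) e' d'"
    unfolding assms(14) by (rule G.complement_strongly_regular)
  have d'_int: "int d' = f * (f + 1)"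
    unfolding d' WW[symmetric] n_int e_int f_def by (simp add: algebra_simps)
  have n'_int: "int (q - 1 - n) = int q - 1 - int n" using n_less by linarith
  have nd': "int (q - 1 - n) - int d' = - ((1 + L) * (1 + f))"
    unfolding n'_int d'_int unfolding WW[symmetric] n_int f_def by (simp add: algebra_simps)
  interpret C: primitive_srg \<Gamma>c q "q - 1 - n" e' d'
    using srg' pos(2,4) nd' d'_int by unfold_locales linarith+
  have n': "q - 1 - n = (k - 1) * n" using nk by (simp add: algebra_simps diff_mult_distrib)
  have n'_mult: "int (q - 1 - n) = (int k - 1) * int n" using k2 unfolding n' by (simp add: of_nat_diff)
  have compl: "graph_complement \<Gamma>c = \<Gamma>" unfolding assms(14) by (rule graph_complement_involutive[OF G.pg])
  have real_eq: "of_int a = real x - real y" if "a = int x - int y" for a x y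
    using that by simp
  have sum: "of_int f + of_int L = real e - real d"
    using real_eq[of "f + L" e d] by (simp add: e_int d_int f_def)
  have prod: "of_int f * of_int L = real d - real n"
    using real_eq[of "f * L" d n] nd by (simp add: mult.commute)
  have sum': "of_int (- 1 - L) + of_int (- 1 - f) = real e' - real d'"
    using real_eq[of "(- 1 - L) + (- 1 - f)" e' d'] by (simp add: e' d' e_int d_int f_def)
  have prod': "of_int (- 1 - L) * of_int (- 1 - f) = real d' - real (q - 1 - n)"
    using real_eq[of "(- 1 - L) * (- 1 - f)" d' "q - 1 - n"] nd' by (simp add: algebra_simps)
  have latin: "pseudo_Latin_square_graph X"
    "\<exists>f g :: real. f > 0 \<and> 0 > g \<and> nontrivial_eigenvalues X = complex_of_real ` {f, g} \<and>
      has_PL_parameters X (- g) (f - g)" if "odd s" "X \<in> {\<Gamma>, \<Gamma>c}" for X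
  proof -
    have q_real: "real q = (of_int f - of_int L)\<^sup>2"
    proof -
      have "real q = of_int (W * W)" unfolding WW by simp
      then show ?thesis by (simp add: f_def power2_eq_square)
    qed
    have "pseudo_Latin_square_graph \<Gamma> \<and>
        (\<exists>f g :: real. f > 0 \<and> 0 > g \<and> nontrivial_eigenvalues \<Gamma> = complex_of_real ` {f, g} \<and>
          has_PL_parameters \<Gamma> (- g) (f - g))"
    proof (rule G.latin_square_parameters[OF _ _ sum prod q_real])
      have "int n = - L * (f - L - 1)" unfolding n_int f_def by simp
      then have "real_of_int (int n) = of_int (- L * (f - L - 1))" by (simp only:)
      then show "real n = - of_int L * (of_int f - of_int L - 1)" by simp
    qed (use signs that(1) in auto)
    moreover have "pseudo_Latin_square_graph \<Gamma>c \<and>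
        (\<exists>f g :: real. f > 0 \<and> 0 > g \<and> nontrivial_eigenvalues \<Gamma>c = complex_of_real ` {f, g} \<and>
          has_PL_parameters \<Gamma>c (- g) (f - g))"
    proof (rule C.latin_square_parameters[OF _ _ sum' prod'])
      show "real q = (of_int (- 1 - L) - of_int (- 1 - f))\<^sup>2" unfolding q_real by simp
      have "int (q - 1 - n) = - (- 1 - f) * ((- 1 - L) - (- 1 - f) - 1)"
        unfolding n'_int n_int WW[symmetric] f_def by (simp add: algebra_simps)
      then have "real_of_int (int (q - 1 - n)) = of_int (- (- 1 - f) * ((- 1 - L) - (- 1 - f) - 1))"
        by (simp only:)
      then show "real (q - 1 - n) =
          - of_int (- 1 - f) * (of_int (- 1 - L) - of_int (- 1 - f) - 1)" by simp
      show "(0 :: real) < of_int (- 1 - L)" using signs that(1) by auto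
      show "real_of_int (- 1 - f) \<le> - 2" using signs that(1) by (simp add: le_diff_eq)
    qed
    ultimately show "pseudo_Latin_square_graph X"
      "\<exists>f g :: real. f > 0 \<and> 0 > g \<and> nontrivial_eigenvalues X = complex_of_real ` {f, g} \<and>
        has_PL_parameters X (- g) (f - g)" using that(2) by blast+
  qed
  have d_real: "real d = real n + (\<sigma> * real p ^ (m div 2) + lambda2) * lambda2"
    using prod unfolding sigma_W lam f_def by (simp add: algebra_simps)
  have e_real: "real e = real d + (\<sigma> * real p ^ (m div 2) + 2 * lambda2)"
    using sum unfolding sigma_W lam f_def by simp
  have e'_real: "real e' = real q - 2 - 2 * real n + real d"
  proof -
    have "real_of_int (int e') = of_int (int q - 2 - 2 * int n + int d)" unfolding e' ..
    then show ?thesis by simp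
  qed
  have d'_real: "real d' = real q - 2 * real n + real e"
  proof -
    have "real_of_int (int d') = of_int (int q - 2 * int n + int e)" unfolding d' ..
    then show ?thesis by simp
  qed
  have prim: "primitive_graph \<Gamma>" "primitive_graph \<Gamma>c"
    unfolding primitive_graph_def compl assms(14)[symmetric] using G.connected C.connected by auto
  have intersection: "has_intersection_array \<Gamma>c ((int k - 1) * int n) (int n - int d) 1
      (int q - 2 * int n + int e)"
  proof -
    have "int (q - 1 - n) - int e' - 1 = int n - int d" unfolding n'_int e' by simp
    then show ?thesis using C.has_intersection_array unfolding n'_mult d' by simp
  qed
  have srg_c: "strongly_regular \<Gamma>c q ((k - 1) * n) e' d'" using srg' unfolding n' .
  show ?thesis
    by (rule exI[of _ e], rule exI[of _ d], rule exI[of _ e'], rule exI[of _ d'],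
        intro conjI impI ballI latin)
      (fact d_real e_real e'_real d'_real srg prim G.not_bipartite G.integral[OF sum prod] srg_c
        C.not_bipartite C.integral[OF sum' prod'] G.distance_regular G.graph_diameter_eq_2
        G.has_intersection_array C.distance_regular C.graph_diameter_eq_2 intersection
       | assumption)+
qed

end
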